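(* Let $K$ and $L$ be compact spaces for which there is a continuous onto mapping $\varphi\colon K\to L$ with a regular averaging operator. If $K$ admits a compensation function, then $L$ admits a compensation function as well.
   Context: A compact space is a compact Hausdorff topological space. For a compact space $K$, $C(K)$ is the Banach space of continuous real-valued functions on $K$ with the supremum norm, $\mathcal{M}(K)=C(K)^*$ is the space of regular Borel signed measures on $K$, $\omega^*$ its weak$^*$ topology, $\mu^+$ the positive part of $\mu\in\mathcal{M}(K)$, and $\mathbf{1}_K$ is the constant function $1$ on $K$. Regular averaging operator: given a continuous onto mapping $\varphi\colon K\to L$ between compact spaces, let $C_\varphi\colon C(L)\to C(K)$ be $C_\varphi(f)=f\circ\varphi$. A bounded linear operator $u\colon C(K)\to C(L)$ is a regular averaging operator for $\varphi$ if $u$ is positive, $u(\mathbf{1}_K)=\mathbf{1}_L$ and $u\circ C_\varphi=\mathrm{id}_{C(L)}$. $\nu\in\mathcal{M}(K)$ is a compensation of $\mu\in\mathcal{M}(K)$ if: $0\le\nu\le\mu^+$ and $\nu(K)=\mu(K)$ in case $\mu(K)>0$; and $\nu=0$ in case $\mu(K)\le 0$. A compensation function for $K$ is an $\omega^*$-$\omega^*$-continuous map $\xi\colon\mathcal{M}(K)\to\mathcal{M}(K)$ such that $\xi(\mu)$ is a compensation of $\mu$ for every $\mu\in\mathcal{M}(K)$. *)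

theory Defs
  imports "HOL-Analysis.Analysis"
begin

text \<open>
  Compact spaces are types \<open>'a::t2_space\<close> with \<open>compact (UNIV :: 'a set)\<close>, and \<open>C(K)\<close> is the
  type \<open>'a \<Rightarrow>\<^sub>C real\<close> of bounded continuous functions with the supremum norm; on a
  compact space all continuous real functions are bounded.
\<close>

text \<open>
  A signed measure is a real set function on the Borel sets. Set functions are total in HOL;
  we give non-Borel sets the value 0, so that two signed measures are equal iff they agree on
  Borel sets.
\<close>

definition borel_signed_measure :: "('a::topological_space set \<Rightarrow> real) \<Rightarrow> bool" where
  "borel_signed_measure \<mu> \<longleftrightarrow>
     \<mu> {} = 0 \<and>
     (\<forall>A :: nat \<Rightarrow> 'a set. range A \<subseteq> sets borel \<longrightarrow> disjoint_family A \<longrightarrow>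
        (\<lambda>i. \<mu> (A i)) sums \<mu> (\<Union>i. A i)) \<and>
     (\<forall>A. A \<notin> sets borel \<longrightarrow> \<mu> A = 0)"

text \<open>
  Positive and negative part (Jordan decomposition). A signed measure with real values is
  bounded, so the supremum is that of a nonempty bounded set.
\<close>

definition pos_part :: "('a::topological_space set \<Rightarrow> real) \<Rightarrow> 'a set \<Rightarrow> real" where
  "pos_part \<mu> A = (if A \<in> sets borel then SUP B\<in>{B \<in> sets borel. B \<subseteq> A}. \<mu> B else 0)"

definition neg_part :: "('a::topological_space set \<Rightarrow> real) \<Rightarrow> 'a set \<Rightarrow> real" where
  "neg_part \<mu> = pos_part (\<lambda>A. - \<mu> A)"

definition total_variation :: "('a::topological_space set \<Rightarrow> real) \<Rightarrow> 'a set \<Rightarrow> real" where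
  "total_variation \<mu> A = pos_part \<mu> A + neg_part \<mu> A"

definition regular_signed_measures :: "('a::topological_space set \<Rightarrow> real) set" where
  "regular_signed_measures =
     {\<mu>. borel_signed_measure \<mu> \<and>
         (\<forall>A \<in> sets borel. \<forall>\<epsilon>>0. \<exists>C U. compact C \<and> open U \<and> C \<subseteq> A \<and> A \<subseteq> U \<and>
            total_variation \<mu> (U - C) < \<epsilon>)}"

definition signed_integral ::
  "('a::topological_space set \<Rightarrow> real) \<Rightarrow> ('a \<Rightarrow>\<^sub>C real) \<Rightarrow> real" where
  "signed_integral \<mu> f =
     (\<integral>x. apply_bcontfun f x \<partial>measure_of UNIV (sets borel) (\<lambda>A. ennreal (pos_part \<mu> A))) -
     (\<integral>x. apply_bcontfun f x \<partial>measure_of UNIV (sets borel) (\<lambda>A. ennreal (neg_part \<mu> A)))"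

text \<open>
  The weak* topology of the dual of \<open>C(K)\<close>: the initial topology of the evaluations
  \<open>\<mu> \<mapsto> \<integral> f d\<mu>\<close>. The \<open>euclidean\<close> topology on functions is the product topology.
\<close>

definition weak_star_topology :: "('a::topological_space set \<Rightarrow> real) topology" where
  "weak_star_topology =
     pullback_topology regular_signed_measures signed_integral
       (euclidean :: (('a \<Rightarrow>\<^sub>C real) \<Rightarrow> real) topology)"

definition compensation ::
  "('a::topological_space set \<Rightarrow> real) \<Rightarrow> ('a set \<Rightarrow> real) \<Rightarrow> bool" where
  "compensation \<nu> \<mu> \<longleftrightarrow>
     \<nu> \<in> regular_signed_measures \<and> \<mu> \<in> regular_signed_measures \<and>
     (\<mu> UNIV > 0 \<longrightarrow>
        (\<forall>A \<in> sets borel. 0 \<le> \<nu> A \<and> \<nu> A \<le> pos_part \<mu> A) \<and> \<nu> UNIV = \<mu> UNIV) \<and>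
     (\<mu> UNIV \<le> 0 \<longrightarrow> \<nu> = (\<lambda>_. 0))"

definition compensation_function ::
  "(('a::topological_space set \<Rightarrow> real) \<Rightarrow> ('a set \<Rightarrow> real)) \<Rightarrow> bool" where
  "compensation_function \<xi> \<longleftrightarrow>
     continuous_map weak_star_topology weak_star_topology \<xi> \<and>
     (\<forall>\<mu> \<in> regular_signed_measures. compensation (\<xi> \<mu>) \<mu>)"

text \<open>\<open>f \<circ> \<phi>\<close> lies in the domain of \<open>Bcontfun\<close> only for continuous \<open>\<phi>\<close>.\<close>

definition composition_operator ::
  "('a::topological_space \<Rightarrow> 'b::topological_space) \<Rightarrow> ('b \<Rightarrow>\<^sub>C real) \<Rightarrow> ('a \<Rightarrow>\<^sub>C real)" where
  "composition_operator \<phi> f = Bcontfun (apply_bcontfun f \<circ> \<phi>)"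

definition regular_averaging_operator ::
  "('a::topological_space \<Rightarrow> 'b::topological_space) \<Rightarrow>
     (('a \<Rightarrow>\<^sub>C real) \<Rightarrow> ('b \<Rightarrow>\<^sub>C real)) \<Rightarrow> bool" where
  "regular_averaging_operator \<phi> u \<longleftrightarrow>
     bounded_linear u \<and>
     (\<forall>f. (\<forall>x. 0 \<le> apply_bcontfun f x) \<longrightarrow> (\<forall>y. 0 \<le> apply_bcontfun (u f) y)) \<and>
     u (const_bcontfun 1) = const_bcontfun 1 \<and>
     u \<circ> composition_operator \<phi> = id"

end

theory Submission
  imports Defs
begin

text \<open>
  Let \<open>u\<^sup>*\<close> be the adjoint of the averaging operator \<open>u\<close> on measures and \<open>\<phi>\<^sub>*\<close> the push-forward. If
  \<open>\<xi>\<close> is a compensation function for \<open>K\<close>, then \<open>\<eta> = \<phi>\<^sub>* \<circ> \<xi> \<circ> u\<^sup>*\<close> is one for \<open>L\<close>. It is weak*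
  continuous because \<open>u\<^sup>*\<close> and \<open>\<phi>\<^sub>*\<close> are adjoints, and \<open>u 1 = 1\<close> gives \<open>(u\<^sup>* \<mu>)(K) = \<mu>(L)\<close>. Positivity
  of \<open>u\<close> yields \<open>\<xi>(u\<^sup>* \<mu>) \<le> (u\<^sup>* \<mu>)\<^sup>+ \<le> u\<^sup>* \<mu>\<^sup>+\<close>, and \<open>\<phi>\<^sub>* u\<^sup>* \<mu>\<^sup>+ = (u \<circ> C\<^sub>\<phi>)\<^sup>* \<mu>\<^sup>+ = \<mu>\<^sup>+\<close>, hence
  \<open>\<eta> \<mu> \<le> \<mu>\<^sup>+\<close>. The measure \<open>u\<^sup>* \<mu>\<close> is the difference of the Riesz measures of the functionals
  \<open>f \<mapsto> \<integral> u f d\<mu>\<^sup>\<plusminus>\<close>.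
\<close>

subsection \<open>Signed measures\<close>

lemma borel_signed_measure_Un:
  assumes \<mu>: "borel_signed_measure \<mu>" and "A \<in> sets borel" "B \<in> sets borel" "A \<inter> B = {}"
  shows "\<mu> (A \<union> B) = \<mu> A + \<mu> B"
proof -
  have "range (binaryset A B) \<subseteq> sets borel"
    using assms by (auto simp: range_binaryset_eq)
  moreover have "disjoint_family (binaryset A B)"
    using assms by (auto simp: disjoint_family_on_def binaryset_def)
  ultimately have "(\<lambda>i. \<mu> (binaryset A B i)) sums \<mu> (\<Union>i. binaryset A B i)"
    using \<mu> unfolding borel_signed_measure_def by blast
  moreover have "(\<lambda>i. \<mu> (binaryset A B i)) sums (\<mu> A + \<mu> B)"
    using \<mu> by (intro binaryset_sums) (simp add: borel_signed_measure_def)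
  ultimately show ?thesis
    by (simp add: UN_binaryset_eq sums_iff)
qed

lemma borel_signed_measure_Diff:
  assumes "borel_signed_measure \<mu>" and "A \<in> sets borel" "B \<in> sets borel" "B \<subseteq> A"
  shows "\<mu> (A - B) = \<mu> A - \<mu> B"
proof -
  have "B \<union> (A - B) = A"
    using assms by blast
  then show ?thesis
    using borel_signed_measure_Un[of \<mu> B "A - B"] assms by auto
qed

lemma borel_signed_measure_uminus:
  "borel_signed_measure \<mu> \<Longrightarrow> borel_signed_measure (\<lambda>A. - \<mu> A)"
  by (auto simp: borel_signed_measure_def intro!: sums_minus)

text \<open>If \<mu> is unbounded on the subsets of \<open>A\<close>, then \<open>A\<close> splits
  into two pieces, both of measure at least 1 in absolute value, and \<mu> is unbounded on the
  subsets of one of them. Keeping that piece and discarding the other, again and again, yields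
  disjoint sets whose measures do not tend to 0, against countable additivity.\<close>

lemma borel_signed_measure_bounded:
  assumes \<mu>: "borel_signed_measure \<mu>"
  shows "\<exists>K. \<forall>A\<in>sets borel. \<bar>\<mu> A\<bar> \<le> K"
proof (rule ccontr)
  define bad where
    "bad A \<longleftrightarrow> A \<in> sets borel \<and> (\<forall>K. \<exists>B\<in>sets borel. B \<subseteq> A \<and> \<bar>\<mu> B\<bar> > K)" for A
  assume unbounded: "\<not> ?thesis"
  have badD: "\<exists>B\<in>sets borel. B \<subseteq> A \<and> \<bar>\<mu> B\<bar> > K" if "bad A" for A K
    using that by (simp only: bad_def)
  from unbounded have "bad UNIV"
    by (auto simp: bad_def not_le)
  have step: "\<exists>A'. bad A' \<and> A' \<subseteq> A \<and> 1 \<le> \<bar>\<mu> (A - A')\<bar>" if badA: "bad A" for A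
  proof -
    have A: "A \<in> sets borel"
      using badA by (simp add: bad_def)
    \<comment> \<open>The margin over \<open>\<bar>\<mu> A\<bar>\<close> forces the complement
      \<open>A - B\<close> to be large as well.\<close>
    obtain B where B: "B \<in> sets borel" "B \<subseteq> A" "\<bar>\<mu> B\<bar> > \<bar>\<mu> A\<bar> + 1"
      using badD[OF badA] by blast
    have large: "1 \<le> \<bar>\<mu> B\<bar>" "1 \<le> \<bar>\<mu> (A - B)\<bar>"
      using borel_signed_measure_Diff[OF \<mu> A B(1,2)] B(3) by linarith+
    have "bad B \<or> bad (A - B)"
    proof (rule ccontr)
      assume "\<not> ?thesis"
      then have "\<exists>K. \<forall>E\<in>sets borel. E \<subseteq> B \<longrightarrow> \<bar>\<mu> E\<bar> \<le> K"
        "\<exists>K. \<forall>E\<in>sets borel. E \<subseteq> A - B \<longrightarrow> \<bar>\<mu> E\<bar> \<le> K"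
        using A B by (simp_all add: bad_def not_less)
      then obtain K1 K2 where K:
        "\<And>E. E \<in> sets borel \<Longrightarrow> E \<subseteq> B \<Longrightarrow> \<bar>\<mu> E\<bar> \<le> K1"
        "\<And>E. E \<in> sets borel \<Longrightarrow> E \<subseteq> A - B \<Longrightarrow> \<bar>\<mu> E\<bar> \<le> K2"
        by metis
      obtain E where E: "E \<in> sets borel" "E \<subseteq> A" "\<bar>\<mu> E\<bar> > K1 + K2"
        using badD[OF badA] by blast
      have "\<bar>\<mu> (E \<inter> B)\<bar> \<le> K1" "\<bar>\<mu> (E - E \<inter> B)\<bar> \<le> K2"
        using E B by (auto intro!: K)
      moreover have "\<mu> (E - E \<inter> B) = \<mu> E - \<mu> (E \<inter> B)"
        using E B by (intro borel_signed_measure_Diff[OF \<mu>]) auto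
      ultimately show False
        using E(3) by linarith
    qed
    moreover have "A - (A - B) = B"
      using B by auto
    ultimately show ?thesis
      using B large by (metis Diff_subset)
  qed
  obtain F where F: "\<And>n::nat. bad (F n)" "\<And>n. F (Suc n) \<subseteq> F n \<and> 1 \<le> \<bar>\<mu> (F n - F (Suc n))\<bar>"
    using dependent_nat_choice[of "\<lambda>_. bad" "\<lambda>_ A A'. A' \<subseteq> A \<and> 1 \<le> \<bar>\<mu> (A - A')\<bar>"]
      \<open>bad UNIV\<close> step by metis
  have dec: "F n \<subseteq> F m" if "m \<le> n" for m n
    using decseqD[OF decseq_SucI that, of F] F by auto
  have "disjoint_family (\<lambda>n. F n - F (Suc n))"
    unfolding disjoint_family_on_def
  proof (intro ballI impI)
    fix m n :: nat
    assume "m \<noteq> n"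
    then have "F n \<subseteq> F (Suc m) \<or> F m \<subseteq> F (Suc n)"
      using dec[of "Suc m" n] dec[of "Suc n" m] by linarith
    then show "(F m - F (Suc m)) \<inter> (F n - F (Suc n)) = {}"
      by blast
  qed
  moreover have "range (\<lambda>n. F n - F (Suc n)) \<subseteq> sets borel"
    using F(1) by (auto simp: bad_def)
  ultimately have "summable (\<lambda>n. \<mu> (F n - F (Suc n)))"
    using \<mu> unfolding borel_signed_measure_def sums_iff by blast
  then have "(\<lambda>n. \<mu> (F n - F (Suc n))) \<longlonglongrightarrow> 0"
    by (rule summable_LIMSEQ_zero)
  then obtain n where "\<bar>\<mu> (F n - F (Suc n))\<bar> < 1"
    using LIMSEQ_D[of "\<lambda>n. \<mu> (F n - F (Suc n))" 0 1] by auto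
  with F(2)[of n] show False
    by simp
qed

section \<open>Jordan decomposition of a signed measure\<close>

lemma pos_part_upper:
  assumes \<mu>: "borel_signed_measure \<mu>" and "A \<in> sets borel" "B \<in> sets borel" "B \<subseteq> A"
  shows "\<mu> B \<le> pos_part \<mu> A"
proof -
  obtain K where "\<forall>A\<in>sets borel. \<bar>\<mu> A\<bar> \<le> K"
    using borel_signed_measure_bounded[OF \<mu>] by blast
  then have "bdd_above (\<mu> ` {B \<in> sets borel. B \<subseteq> A})"
    by (auto intro!: bdd_aboveI[of _ K] simp: abs_le_iff)
  then show ?thesis
    using assms by (auto simp: pos_part_def intro!: cSUP_upper)
qed

lemma pos_part_least:
  assumes "A \<in> sets borel" "\<And>B. B \<in> sets borel \<Longrightarrow> B \<subseteq> A \<Longrightarrow> \<mu> B \<le> c"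
  shows "pos_part \<mu> A \<le> c"
  using assms by (auto simp: pos_part_def intro!: cSUP_least)

lemma pos_part_nonneg: "borel_signed_measure \<mu> \<Longrightarrow> 0 \<le> pos_part \<mu> A"
  using pos_part_upper[of \<mu> A "{}"]
  by (cases "A \<in> sets borel") (auto simp: borel_signed_measure_def pos_part_def)

lemma pos_part_empty: "borel_signed_measure \<mu> \<Longrightarrow> pos_part \<mu> {} = 0"
  by (auto simp: borel_signed_measure_def pos_part_def)

lemma pos_part_mono:
  "borel_signed_measure \<mu> \<Longrightarrow> A \<in> sets borel \<Longrightarrow> B \<in> sets borel \<Longrightarrow> A \<subseteq> B \<Longrightarrow>
    pos_part \<mu> A \<le> pos_part \<mu> B"
  by (auto intro!: pos_part_least intro: pos_part_upper)

lemma pos_part_superadditive: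
  assumes \<mu>: "borel_signed_measure \<mu>" and A: "A \<in> sets borel" and B: "B \<in> sets borel"
    and disj: "A \<inter> B = {}"
  shows "pos_part \<mu> A + pos_part \<mu> B \<le> pos_part \<mu> (A \<union> B)"
proof -
  \<comment> \<open>The two suprema are resolved one after the other: first for a fixed
    \<open>A'\<close> in \<open>A\<close>, then for a fixed \<open>B'\<close> in
    \<open>B\<close>.\<close>
  have "pos_part \<mu> A \<le> pos_part \<mu> (A \<union> B) - pos_part \<mu> B"
  proof (rule pos_part_least[OF A])
    fix A' assume A': "A' \<in> sets borel" "A' \<subseteq> A"
    have "pos_part \<mu> B \<le> pos_part \<mu> (A \<union> B) - \<mu> A'"
    proof (rule pos_part_least[OF B])
      fix B' assume B': "B' \<in> sets borel" "B' \<subseteq> B"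
      have "\<mu> A' + \<mu> B' = \<mu> (A' \<union> B')"
        using A' B' disj by (intro borel_signed_measure_Un[OF \<mu>, symmetric]) auto
      also have "\<dots> \<le> pos_part \<mu> (A \<union> B)"
        using A B A' B' by (intro pos_part_upper[OF \<mu>]) auto
      finally show "\<mu> B' \<le> pos_part \<mu> (A \<union> B) - \<mu> A'"
        by simp
    qed
    then show "\<mu> A' \<le> pos_part \<mu> (A \<union> B) - pos_part \<mu> B"
      by simp
  qed
  then show ?thesis
    by simp
qed

text \<open>Superadditivity bounds the partial sums by the value on the union, which also gives
  summability. Conversely, a Borel subset \<open>B\<close> of the union is the disjoint union of its
  traces \<open>B \<inter> A i\<close>, so \<mu> \<open>B\<close> is at most the sum.\<close>

lemma pos_part_sums:
  assumes \<mu>: "borel_signed_measure \<mu>" and A: "range A \<subseteq> sets borel" and disj: "disjoint_family A"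
  shows "(\<lambda>i. pos_part \<mu> (A i)) sums pos_part \<mu> (\<Union>i::nat. A i)"
proof -
  have UA: "(\<Union>i\<in>I. A i) \<in> sets borel" for I
    using A by auto
  have partial: "(\<Sum>i<n. pos_part \<mu> (A i)) \<le> pos_part \<mu> (\<Union>i<n. A i)" for n
  proof (induction n)
    case (Suc n)
    have "A i \<inter> A n = {}" if "i < n" for i
      using that by (intro disjoint_family_onD[OF disj]) auto
    then have "(\<Union>i<n. A i) \<inter> A n = {}"
      by blast
    then have "pos_part \<mu> (\<Union>i<n. A i) + pos_part \<mu> (A n) \<le> pos_part \<mu> ((\<Union>i<n. A i) \<union> A n)"
      using A UA by (intro pos_part_superadditive[OF \<mu>]) auto
    moreover have "(\<Union>i<n. A i) \<union> A n = (\<Union>i<Suc n. A i)"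
      by (auto simp: less_Suc_eq)
    ultimately show ?case
      using Suc by simp
  qed (simp add: pos_part_empty[OF \<mu>])
  have bound: "(\<Sum>i<n. pos_part \<mu> (A i)) \<le> pos_part \<mu> (\<Union>i. A i)" for n
    using partial[of n] pos_part_mono[OF \<mu> UA[of "{..<n}"] UA[of UNIV]] by fastforce
  have summable: "summable (\<lambda>i. pos_part \<mu> (A i))"
    using pos_part_nonneg[OF \<mu>] bound by (rule summableI_nonneg_bounded)
  have "pos_part \<mu> (\<Union>i. A i) \<le> (\<Sum>i. pos_part \<mu> (A i))"
  proof (rule pos_part_least[OF UA])
    fix B assume B: "B \<in> sets borel" "B \<subseteq> (\<Union>i. A i)"
    have "range (\<lambda>i. B \<inter> A i) \<subseteq> sets borel"
      using A B by auto
    moreover have "disjoint_family (\<lambda>i. B \<inter> A i)"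
      by (rule disjoint_family_on_bisimulation[OF disj]) blast
    ultimately have "(\<lambda>i. \<mu> (B \<inter> A i)) sums \<mu> (\<Union>i. B \<inter> A i)"
      using \<mu> unfolding borel_signed_measure_def by blast
    also have "(\<Union>i. B \<inter> A i) = B"
      using B by auto
    finally have sumB: "(\<lambda>i. \<mu> (B \<inter> A i)) sums \<mu> B" .
    have le: "\<mu> (B \<inter> A i) \<le> pos_part \<mu> (A i)" for i
      using A B by (intro pos_part_upper[OF \<mu>]) auto
    show "\<mu> B \<le> (\<Sum>i. pos_part \<mu> (A i))"
      by (rule sums_le[OF le sumB summable_sums[OF summable]])
  qed
  moreover have "(\<Sum>i. pos_part \<mu> (A i)) \<le> pos_part \<mu> (\<Union>i. A i)"
    using summable bound by (rule suminf_le_const)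
  ultimately show ?thesis
    using summable by (simp add: sums_iff)
qed

text \<open>Passing from \<open>B\<close> to \<open>A - B\<close> turns \<open>- \<mu> B\<close>
  into \<open>\<mu> (A - B) - \<mu> A\<close>, so the two suprema differ by \<mu> \<open>A\<close>.
  This is the Jordan decomposition, obtained without a Hahn set.\<close>

lemma neg_part_eq:
  assumes \<mu>: "borel_signed_measure \<mu>" and A: "A \<in> sets borel"
  shows "neg_part \<mu> A = pos_part \<mu> A - \<mu> A"
proof (rule antisym)
  show "neg_part \<mu> A \<le> pos_part \<mu> A - \<mu> A"
    unfolding neg_part_def
  proof (rule pos_part_least[OF A])
    fix B assume B: "B \<in> sets borel" "B \<subseteq> A"
    then show "- \<mu> B \<le> pos_part \<mu> A - \<mu> A"
      using pos_part_upper[OF \<mu> A, of "A - B"] borel_signed_measure_Diff[OF \<mu> A B] A by simp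
  qed
  have "pos_part \<mu> A \<le> neg_part \<mu> A + \<mu> A"
  proof (rule pos_part_least[OF A])
    fix B assume B: "B \<in> sets borel" "B \<subseteq> A"
    then show "\<mu> B \<le> neg_part \<mu> A + \<mu> A"
      using pos_part_upper[OF borel_signed_measure_uminus[OF \<mu>] A, of "A - B"]
        borel_signed_measure_Diff[OF \<mu> A B] A by (simp add: neg_part_def)
  qed
  then show "pos_part \<mu> A - \<mu> A \<le> neg_part \<mu> A"
    by simp
qed

section \<open>Positive parts as measures, and regularity\<close>

definition pos_measure :: "('a::topological_space set \<Rightarrow> real) \<Rightarrow> 'a measure" where
  "pos_measure \<mu> = measure_of UNIV (sets borel) (\<lambda>A. ennreal (pos_part \<mu> A))"

lemma sets_pos_measure [measurable_cong]: "sets (pos_measure \<mu>) = sets borel"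
  using sets.sigma_sets_eq[of borel] by (simp add: pos_measure_def)

lemma emeasure_pos_measure:
  assumes \<mu>: "borel_signed_measure \<mu>" and A: "A \<in> sets borel"
  shows "emeasure (pos_measure \<mu>) A = ennreal (pos_part \<mu> A)"
proof (rule emeasure_measure_of[OF pos_measure_def])
  show "positive (sets (pos_measure \<mu>)) (\<lambda>A. ennreal (pos_part \<mu> A))"
    by (simp add: positive_def pos_part_empty[OF \<mu>])
  show "countably_additive (sets (pos_measure \<mu>)) (\<lambda>A. ennreal (pos_part \<mu> A))"
    unfolding countably_additive_def sets_pos_measure
    using pos_part_sums[OF \<mu>] pos_part_nonneg[OF \<mu>]
    by (auto simp: sums_iff suminf_ennreal2)
qed (use A in \<open>auto simp: sets_pos_measure\<close>)

lemma finite_measure_pos_measure: "borel_signed_measure \<mu> \<Longrightarrow> finite_measure (pos_measure \<mu>)"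
  by (rule finite_measureI)
    (simp add: emeasure_pos_measure sets_eq_imp_space_eq[OF sets_pos_measure])

lemma measure_pos_measure:
  assumes \<mu>: "borel_signed_measure \<mu>"
  shows "measure (pos_measure \<mu>) = pos_part \<mu>"
proof
  fix A
  show "measure (pos_measure \<mu>) A = pos_part \<mu> A"
  proof (cases "A \<in> sets borel")
    case True
    then show ?thesis
      by (simp add: measure_def emeasure_pos_measure[OF \<mu>] pos_part_nonneg[OF \<mu>])
  next
    case False
    then show ?thesis
      by (simp add: measure_notin_sets sets_pos_measure pos_part_def)
  qed
qed

lemma signed_integral_pos_measure:
  "signed_integral \<mu> f =
    (\<integral>x. apply_bcontfun f x \<partial>pos_measure \<mu>) - (\<integral>x. apply_bcontfun f x \<partial>pos_measure (\<lambda>A. - \<mu> A))"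
  by (simp add: signed_integral_def pos_measure_def neg_part_def)

text \<open>The unsigned counterpart of \<open>regular_signed_measures\<close>, with the measure
  itself in place of the total variation. Both Jordan parts of a regular signed measure have this
  property.\<close>

definition regular_measure :: "'a::topological_space measure \<Rightarrow> bool" where
  "regular_measure M \<longleftrightarrow> sets M = sets borel \<and> finite_measure M \<and>
     (\<forall>A\<in>sets borel. \<forall>\<epsilon>>0. \<exists>C U. compact C \<and> open U \<and> C \<subseteq> A \<and> A \<subseteq> U \<and> measure M (U - C) < \<epsilon>)"

lemma borel_signed_measure_diff:
  fixes M N :: "'a::topological_space measure"
  assumes "finite_measure M" "finite_measure N" "sets M = sets borel" "sets N = sets borel"
  shows "borel_signed_measure (\<lambda>A. measure M A - measure N A)"
  unfolding borel_signed_measure_def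
proof (intro conjI allI impI)
  fix A :: "nat \<Rightarrow> 'a set"
  assume "range A \<subseteq> sets borel" "disjoint_family A"
  then show "(\<lambda>i. measure M (A i) - measure N (A i)) sums (measure M (\<Union>i. A i) - measure N (\<Union>i. A i))"
    using assms by (intro sums_diff finite_measure.finite_measure_UNION) auto
qed (use assms in \<open>simp_all add: measure_notin_sets\<close>)

text \<open>Minimality of the Jordan decomposition: discarding the subtracted measure only enlarges
  the supremum. For the adjoint of \<open>u\<close> this becomes
  \<open>(u\<^sup>* \<mu>)\<^sup>+ \<le> u\<^sup>* \<mu>\<^sup>+\<close>.\<close>

lemma pos_part_diff_le:
  fixes M N :: "'a::topological_space measure"
  assumes "finite_measure M" "sets M = sets borel" "A \<in> sets borel"
  shows "pos_part (\<lambda>A. measure M A - measure N A) A \<le> measure M A"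
proof (rule pos_part_least)
  fix B assume "B \<in> sets borel" "B \<subseteq> A"
  then have "measure M B \<le> measure M A"
    using assms by (intro finite_measure.finite_measure_mono) auto
  then show "measure M B - measure N B \<le> measure M A"
    using measure_nonneg[of N B] by linarith
qed fact

text \<open>The Jordan parts of the difference are dominated by \<open>M\<close> and
  \<open>N\<close>. Approximations for \<open>M\<close> and for \<open>N\<close> are combined by
  uniting the compact sets and intersecting the open ones.\<close>

lemma regular_signed_measures_diff:
  fixes M N :: "'a::t2_space measure"
  assumes M: "regular_measure M" and N: "regular_measure N"
  shows "(\<lambda>A. measure M A - measure N A) \<in> regular_signed_measures"
proof -
  define \<mu> where "\<mu> = (\<lambda>A. measure M A - measure N A)"
  have sets: "sets M = sets borel" "sets N = sets borel" and fin: "finite_measure M" "finite_measure N"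
    using M N by (auto simp: regular_measure_def)
  have "\<exists>C U. compact C \<and> open U \<and> C \<subseteq> A \<and> A \<subseteq> U \<and> total_variation \<mu> (U - C) < \<epsilon>"
    if A: "A \<in> sets borel" and "\<epsilon> > 0" for A \<epsilon>
  proof -
    obtain C1 U1 where 1: "compact C1" "open U1" "C1 \<subseteq> A" "A \<subseteq> U1" "measure M (U1 - C1) < \<epsilon> / 2"
      using M A \<open>\<epsilon> > 0\<close> unfolding regular_measure_def by (meson half_gt_zero)
    obtain C2 U2 where 2: "compact C2" "open U2" "C2 \<subseteq> A" "A \<subseteq> U2" "measure N (U2 - C2) < \<epsilon> / 2"
      using N A \<open>\<epsilon> > 0\<close> unfolding regular_measure_def by (meson half_gt_zero)
    define D where "D = (U1 \<inter> U2) - (C1 \<union> C2)"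
    have D: "D \<in> sets borel" "U1 - C1 \<in> sets borel" "U2 - C2 \<in> sets borel"
      using 1 2 by (auto simp: D_def compact_imp_closed intro!: borel_open borel_closed)
    have "pos_part \<mu> D \<le> measure M D" "neg_part \<mu> D \<le> measure N D"
      using pos_part_diff_le[OF fin(1) sets(1) D(1), of N] pos_part_diff_le[OF fin(2) sets(2) D(1), of M]
      by (simp_all add: \<mu>_def neg_part_def)
    moreover have "measure M D \<le> measure M (U1 - C1)" "measure N D \<le> measure N (U2 - C2)"
      using D sets fin by (auto intro!: finite_measure.finite_measure_mono simp: D_def)
    ultimately have "total_variation \<mu> D < \<epsilon>"
      using 1 2 by (simp add: total_variation_def)
    then show ?thesis
      using 1 2 by (intro exI[of _ "C1 \<union> C2"] exI[of _ "U1 \<inter> U2"]) (auto simp: D_def)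
  qed
  moreover have "borel_signed_measure \<mu>"
    unfolding \<mu>_def by (rule borel_signed_measure_diff[OF fin sets])
  ultimately have "\<mu> \<in> regular_signed_measures"
    by (simp add: regular_signed_measures_def)
  then show ?thesis
    by (simp add: \<mu>_def)
qed

lemma regular_measure_null: "regular_measure (null_measure (borel :: 'a::topological_space measure))"
proof -
  have "\<exists>C U. compact C \<and> open U \<and> C \<subseteq> A \<and> A \<subseteq> U" for A :: "'a set"
    by (intro exI[of _ "{}"] exI[of _ UNIV]) auto
  then show ?thesis
    by (auto simp: regular_measure_def intro!: finite_measureI)
qed

lemma regular_signed_measures_measure:
  fixes M :: "'a::t2_space measure"
  shows "regular_measure M \<Longrightarrow> measure M \<in> regular_signed_measures"
  using regular_signed_measures_diff[OF _ regular_measure_null] by fastforce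

lemma regular_pos_measure:
  fixes \<mu> :: "'a::topological_space set \<Rightarrow> real"
  assumes \<mu>: "\<mu> \<in> regular_signed_measures"
  shows "regular_measure (pos_measure \<mu>)" "regular_measure (pos_measure (\<lambda>A. - \<mu> A))"
proof -
  have bsm: "borel_signed_measure \<mu>"
    using \<mu> by (simp add: regular_signed_measures_def)
  note bsm' = borel_signed_measure_uminus[OF bsm]
  have *: "\<exists>C U. compact C \<and> open U \<and> C \<subseteq> A \<and> A \<subseteq> U \<and>
      pos_part \<mu> (U - C) < \<epsilon> \<and> pos_part (\<lambda>A. - \<mu> A) (U - C) < \<epsilon>"
    if A: "A \<in> sets borel" and \<epsilon>: "\<epsilon> > 0" for A \<epsilon>
  proof -
    obtain C U where "compact C" "open U" "C \<subseteq> A" "A \<subseteq> U" "total_variation \<mu> (U - C) < \<epsilon>"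
      using \<mu> A \<epsilon> unfolding regular_signed_measures_def by blast
    then show ?thesis
      using pos_part_nonneg[OF bsm, of "U - C"] pos_part_nonneg[OF bsm', of "U - C"]
      by (intro exI[of _ C] exI[of _ U]) (auto simp: total_variation_def neg_part_def)
  qed
  show "regular_measure (pos_measure \<mu>)" "regular_measure (pos_measure (\<lambda>A. - \<mu> A))"
    using * by (auto simp: regular_measure_def sets_pos_measure measure_pos_measure
        finite_measure_pos_measure bsm bsm') meson+
qed

lemma pos_part_of_nonneg:
  assumes \<mu>: "borel_signed_measure \<mu>" and nonneg: "\<And>A. A \<in> sets borel \<Longrightarrow> 0 \<le> \<mu> A"
  shows "pos_part \<mu> = \<mu>"
proof
  fix A
  show "pos_part \<mu> A = \<mu> A"
  proof (cases "A \<in> sets borel")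
    case A: True
    have "\<mu> B \<le> \<mu> A" if "B \<in> sets borel" "B \<subseteq> A" for B
      using borel_signed_measure_Diff[OF \<mu> A that] nonneg[of "A - B"] A that by simp
    then show ?thesis
      using A pos_part_upper[OF \<mu> A A] by (auto intro!: antisym pos_part_least)
  next
    case False
    then show ?thesis
      using \<mu> by (simp add: borel_signed_measure_def pos_part_def)
  qed
qed

section \<open>Integrals against differences of measures\<close>

lemma integrable_bcontfun:
  fixes f :: "'a::topological_space \<Rightarrow>\<^sub>C real"
  assumes "finite_measure M" "sets M = sets borel"
  shows "integrable M (apply_bcontfun f)"
proof (rule finite_measure.integrable_const_bound[OF assms(1)])
  show "AE x in M. norm (apply_bcontfun f x) \<le> norm f"
    using norm_bounded[of f] by (intro AE_I2)
  show "apply_bcontfun f \<in> borel_measurable M"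
    using borel_measurable_continuous_onI[of "apply_bcontfun f"]
    by (simp add: measurable_cong_sets[OF assms(2) refl])
qed

text \<open>An equality between two differences of measures, rearranged into sums so that infinite
  integrals do no harm. It passes from sets to functions by the standard induction on nonnegative
  measurable functions.\<close>

lemma nn_integral_eq_if_emeasure_add_eq:
  assumes sets: "sets N = sets M" "sets M' = sets M" "sets N' = sets M"
    and eq: "\<And>A. A \<in> sets M \<Longrightarrow> emeasure M A + emeasure N A = emeasure M' A + emeasure N' A"
    and f: "f \<in> borel_measurable M"
  shows "(\<integral>\<^sup>+x. f x \<partial>M) + (\<integral>\<^sup>+x. f x \<partial>N) = (\<integral>\<^sup>+x. f x \<partial>M') + (\<integral>\<^sup>+x. f x \<partial>N')"
  using f
proof (induction rule: borel_measurable_induct)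
  case (cong f g)
  have "space N = space M" "space M' = space M" "space N' = space M"
    using sets by (auto dest: sets_eq_imp_space_eq)
  then have "(\<integral>\<^sup>+x. f x \<partial>K) = (\<integral>\<^sup>+x. g x \<partial>K)" if "K \<in> {M, N, M', N'}" for K
    using that cong(3) by (intro nn_integral_cong) auto
  then show ?case
    using cong(4) by simp
next
  case (set A)
  then show ?case
    using eq[of A] sets by simp
next
  case (mult u c)
  have "u \<in> borel_measurable N" "u \<in> borel_measurable M'" "u \<in> borel_measurable N'"
    using mult(2) sets by (simp_all cong: measurable_cong_sets)
  then show ?case
    using mult by (simp add: nn_integral_cmult flip: distrib_left)
next
  case (add u v)
  have meas: "u \<in> borel_measurable K" "v \<in> borel_measurable K" if "K \<in> {M, N, M', N'}" for K
    using that add.hyps(1,3) sets by (auto cong: measurable_cong_sets)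
  have "(\<integral>\<^sup>+x. v x + u x \<partial>K) = (\<integral>\<^sup>+x. v x \<partial>K) + (\<integral>\<^sup>+x. u x \<partial>K)" if "K \<in> {M, N, M', N'}" for K
    using meas[OF that] by (intro nn_integral_add)
  then show ?case
    using arg_cong2[OF add.IH, of "(+)"] by (simp add: ac_simps)
next
  case (seq U)
  have meas: "U i \<in> borel_measurable N" "U i \<in> borel_measurable M'" "U i \<in> borel_measurable N'" for i
    using seq(1) sets by (simp_all cong: measurable_cong_sets)
  have mono: "incseq (\<lambda>i. \<integral>\<^sup>+x. U i x \<partial>K)" for K
    using seq(3) by (auto simp: incseq_def le_fun_def intro!: nn_integral_mono)
  have "(\<integral>\<^sup>+x. (SUP i. U i) x \<partial>K) = (SUP i. \<integral>\<^sup>+x. U i x \<partial>K)" if "K \<in> {M, N, M', N'}" for K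
    using that seq(1,3) meas unfolding SUP_apply
    by (auto intro!: nn_integral_monotone_convergence_SUP)
  then show ?case
    using seq.IH by (simp add: ennreal_SUP_add[OF mono mono, symmetric])
qed

lemma integral_eq_if_measure_add_eq:
  fixes f :: "'a \<Rightarrow> real"
  assumes fin: "finite_measure M" "finite_measure N" "finite_measure M'" "finite_measure N'"
    and sets: "sets N = sets M" "sets M' = sets M" "sets N' = sets M"
    and int: "integrable M f" "integrable N f" "integrable M' f" "integrable N' f"
    and eq: "\<And>A. A \<in> sets M \<Longrightarrow> measure M A + measure N A = measure M' A + measure N' A"
  shows "integral\<^sup>L M f + integral\<^sup>L N f = integral\<^sup>L M' f + integral\<^sup>L N' f"
proof -
  have emeasure_eq: "emeasure M A + emeasure N A = emeasure M' A + emeasure N' A"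
    if "A \<in> sets M" for A
    using eq[OF that] fin by (simp add: finite_measure.emeasure_eq_measure flip: ennreal_plus)
  have nn: "(\<integral>\<^sup>+x. g x \<partial>M) + (\<integral>\<^sup>+x. g x \<partial>N) = (\<integral>\<^sup>+x. g x \<partial>M') + (\<integral>\<^sup>+x. g x \<partial>N')"
    if "g \<in> borel_measurable M" for g
    using emeasure_eq that by (rule nn_integral_eq_if_emeasure_add_eq[OF sets])
  \<comment> \<open>Since \<open>ennreal\<close> sends negative reals to 0, \<open>s = 1\<close> and
    \<open>s = -1\<close> treat the positive and the negative part of \<open>f\<close>
    together.\<close>
  have part: "(\<integral>\<^sup>+x. ennreal (s * f x) \<partial>K) < \<infinity>" if "K \<in> {M, N, M', N'}" "s \<in> {1, -1}" for K and s :: real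
  proof -
    have "integrable K (\<lambda>x. s * f x)"
      using that int by auto
    then have "(\<integral>\<^sup>+x. ennreal (norm (s * f x)) \<partial>K) < \<infinity>"
      unfolding integrable_iff_bounded by blast
    moreover have "(\<integral>\<^sup>+x. ennreal (s * f x) \<partial>K) \<le> (\<integral>\<^sup>+x. ennreal (norm (s * f x)) \<partial>K)"
      by (intro nn_integral_mono ennreal_leI) auto
    ultimately show ?thesis
      by (rule le_less_trans[rotated])
  qed
  have f: "(\<lambda>x. ennreal (s * f x)) \<in> borel_measurable M" for s
    using borel_measurable_integrable[OF int(1)] by measurable
  have "enn2real (\<integral>\<^sup>+x. ennreal (s * f x) \<partial>M) + enn2real (\<integral>\<^sup>+x. ennreal (s * f x) \<partial>N) =
    enn2real (\<integral>\<^sup>+x. ennreal (s * f x) \<partial>M') + enn2real (\<integral>\<^sup>+x. ennreal (s * f x) \<partial>N')"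
    if s: "s \<in> {1, -1}" for s
    using nn[OF f, of s] part[OF _ s] by (simp flip: enn2real_plus)
  from this[of 1] this[of "-1"] show ?thesis
    using int by (simp add: real_lebesgue_integral_def)
qed

text \<open>\<open>signed_integral\<close> is defined by the Jordan parts, whereas \<open>M\<close>
  and \<open>N\<close> may overlap. The identity between the two decompositions of \<mu> is
  rearranged into sums of positive measures, which have equal integrals.\<close>

lemma signed_integral_diff:
  fixes M N :: "'a::t2_space measure"
  assumes fin: "finite_measure M" "finite_measure N" and sets: "sets M = sets borel" "sets N = sets borel"
  shows "signed_integral (\<lambda>A. measure M A - measure N A) f =
    (\<integral>x. apply_bcontfun f x \<partial>M) - (\<integral>x. apply_bcontfun f x \<partial>N)"
proof -
  define \<mu> where "\<mu> = (\<lambda>A. measure M A - measure N A)"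
  have bsm: "borel_signed_measure \<mu>"
    unfolding \<mu>_def by (rule borel_signed_measure_diff[OF fin sets])
  note bsm' = borel_signed_measure_uminus[OF bsm]
  note fins = finite_measure_pos_measure[OF bsm] finite_measure_pos_measure[OF bsm']
  have "(\<integral>x. apply_bcontfun f x \<partial>pos_measure \<mu>) + (\<integral>x. apply_bcontfun f x \<partial>N) =
    (\<integral>x. apply_bcontfun f x \<partial>M) + (\<integral>x. apply_bcontfun f x \<partial>pos_measure (\<lambda>A. - \<mu> A))"
  proof (rule integral_eq_if_measure_add_eq)
    fix A assume "A \<in> sets (pos_measure \<mu>)"
    then have "pos_part (\<lambda>A. - \<mu> A) A = pos_part \<mu> A - \<mu> A"
      using neg_part_eq[OF bsm, of A] by (simp add: sets_pos_measure neg_part_def)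
    moreover have "\<mu> A = measure M A - measure N A"
      by (simp add: \<mu>_def)
    ultimately show "measure (pos_measure \<mu>) A + measure N A =
        measure M A + measure (pos_measure (\<lambda>A. - \<mu> A)) A"
      by (simp add: measure_pos_measure[OF bsm] measure_pos_measure[OF bsm'])
  qed (simp_all add: fin fins sets sets_pos_measure integrable_bcontfun)
  then show ?thesis
    by (simp add: signed_integral_pos_measure flip: \<mu>_def)
qed

lemma signed_integral_measure:
  fixes M :: "'a::t2_space measure"
  assumes "finite_measure M" "sets M = sets borel"
  shows "signed_integral (measure M) f = (\<integral>x. apply_bcontfun f x \<partial>M)"
proof -
  have "finite_measure (null_measure (borel :: 'a measure))"
    by (auto intro!: finite_measureI)
  from signed_integral_diff[OF assms(1) this assms(2), of f] show ?thesis
    by simp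
qed

subsection \<open>The Riesz representation theorem\<close>

lemma normal_space_euclidean:
  assumes "compact (UNIV :: 'a::t2_space set)"
  shows "normal_space (euclidean :: 'a topology)"
proof (rule compact_Hausdorff_or_regular_imp_normal_space)
  show "compact_space (euclidean :: 'a topology)"
    using assms by (simp add: compact_space_def)
  show "Hausdorff_space (euclidean :: 'a topology) \<or> regular_space (euclidean :: 'a topology)"
    unfolding Hausdorff_space_def disjnt_def by (metis hausdorff open_openin)
qed

lemma compact_Urysohn:
  fixes S T :: "'a::t2_space set"
  assumes "compact (UNIV :: 'a set)" "closed S" "closed T" "S \<inter> T = {}"
  obtains f :: "'a \<Rightarrow> real"
  where "continuous_on UNIV f" "\<And>x. 0 \<le> f x" "\<And>x. f x \<le> 1"
    "\<And>x. x \<in> S \<Longrightarrow> f x = 1" "\<And>x. x \<in> T \<Longrightarrow> f x = 0"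
proof -
  obtain f where f: "continuous_map euclidean (top_of_set {0..1::real}) f" "f ` T \<subseteq> {0}" "f ` S \<subseteq> {1}"
    using Urysohn_lemma[OF normal_space_euclidean[OF assms(1)], of T S 0 1] assms
    by (auto simp: disjnt_def Int_commute)
  then have "continuous_on UNIV f" "range f \<subseteq> {0..1}"
    by (auto simp: continuous_map_in_subtopology)
  with f that[of f] show ?thesis
    by (auto simp: image_subset_iff)
qed

lemma continuous_imp_bcontfun:
  fixes f :: "'a::topological_space \<Rightarrow> 'b::metric_space"
  assumes "compact (UNIV :: 'a set)" "continuous_on UNIV f"
  shows "f \<in> bcontfun"
  using assms compact_imp_bounded[OF compact_continuous_image] by (auto simp: bcontfun_def)

text \<open>A positive functional on \<open>C(K)\<close>, encoded on all functions but with laws for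
  continuous ones only. It can thus be applied directly to lambda terms.\<close>

locale positive_functional =
  fixes L :: "('a::t2_space \<Rightarrow> real) \<Rightarrow> real"
  assumes compact_UNIV: "compact (UNIV :: 'a set)"
    and add: "continuous_on UNIV f \<Longrightarrow> continuous_on UNIV g \<Longrightarrow> L (\<lambda>x. f x + g x) = L f + L g"
    and cmult: "continuous_on UNIV f \<Longrightarrow> L (\<lambda>x. c * f x) = c * L f"
    and nonneg: "continuous_on UNIV f \<Longrightarrow> (\<And>x. 0 \<le> f x) \<Longrightarrow> 0 \<le> L f"
begin

lemma mono:
  assumes "continuous_on UNIV f" "continuous_on UNIV g" "\<And>x. f x \<le> g x"
  shows "L f \<le> L g"
proof -
  have "0 \<le> L (\<lambda>x. g x - f x)"
    using assms by (intro nonneg continuous_intros) auto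
  moreover have "L g = L (\<lambda>x. (g x - f x) + f x)"
    by simp
  moreover have "\<dots> = L (\<lambda>x. g x - f x) + L f"
    using assms by (intro add continuous_intros)
  ultimately show ?thesis
    by linarith
qed

lemma zero: "L (\<lambda>x. 0) = 0"
  using cmult[of "\<lambda>x. 0" 0] by simp

lemma sum:
  assumes "\<And>i. i \<in> I \<Longrightarrow> continuous_on UNIV (f i)"
  shows "L (\<lambda>x. \<Sum>i\<in>I. f i x) = (\<Sum>i\<in>I. L (f i))"
  using assms
proof (induction I rule: infinite_finite_induct)
  case (insert i I)
  then show ?case
    by (simp add: add continuous_on_sum)
qed (simp_all add: zero)

section \<open>Content of open sets and the induced outer measure\<close>

definition below :: "'a set \<Rightarrow> ('a \<Rightarrow> real) set" where
  "below U = {f. continuous_on UNIV f \<and> (\<forall>x. 0 \<le> f x \<and> f x \<le> 1) \<and> (\<forall>x. x \<notin> U \<longrightarrow> f x = 0)}"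

text \<open>Riesz's content of an open set. Functions in \<open>below U\<close> only have to vanish
  off \<open>U\<close>, which is weaker than compact support in \<open>U\<close>;
  \<open>below_cut\<close> bridges the gap up to an arbitrarily small error.\<close>

definition content :: "'a set \<Rightarrow> ennreal" where
  "content U = (SUP f\<in>below U. ennreal (L f))"

definition outer :: "'a set \<Rightarrow> ennreal" where
  "outer A = (INF U\<in>{U. open U \<and> A \<subseteq> U}. content U)"

lemma below_nonneg: "f \<in> below U \<Longrightarrow> 0 \<le> L f"
  by (auto simp: below_def intro: nonneg)

lemma zero_below: "(\<lambda>x. 0) \<in> below U"
  by (simp add: below_def)

lemma content_upper: "f \<in> below U \<Longrightarrow> ennreal (L f) \<le> content U"
  unfolding content_def by (rule SUP_upper)

lemma content_mono: "U \<subseteq> V \<Longrightarrow> content U \<le> content V"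
  unfolding content_def by (rule SUP_subset_mono) (auto simp: below_def)

lemma content_empty: "content {} = 0"
proof -
  have "below {} = {\<lambda>x. 0}"
    by (auto simp: below_def)
  then show ?thesis
    by (simp add: content_def zero)
qed

text \<open>Truncating at a small height shrinks the support to a compact subset.\<close>

lemma below_cut:
  assumes f: "f \<in> below U" and "e > 0"
  obtains C g where "closed C" "C \<subseteq> U" "g \<in> below C" "L f \<le> L g + e"
proof -
  \<comment> \<open>Lowering \<open>f\<close> by \<open>d\<close> costs at most
    \<open>d * L (\<lambda>x. 1)\<close>, which is to stay below \<open>e\<close>. The summand 1
    keeps the denominator positive when \<open>L (\<lambda>x. 1)\<close> is 0.\<close>
  define d where "d = e / (L (\<lambda>x. 1) + 1)"
  have L1: "0 \<le> L (\<lambda>x. 1)"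
    by (rule nonneg) auto
  then have d: "d > 0" "d * L (\<lambda>x. 1) \<le> e"
    using \<open>e > 0\<close> by (auto simp: d_def field_simps)
  define C where "C = {x. d \<le> f x}"
  define g where "g = (\<lambda>x. max 0 (f x - d))"
  have cont: "continuous_on UNIV f" "continuous_on UNIV g"
    using f by (auto simp: below_def g_def intro!: continuous_intros)
  have "L f \<le> L (\<lambda>x. g x + d * 1)"
    using cont by (intro mono continuous_intros) (auto simp: g_def)
  also have "\<dots> = L g + d * L (\<lambda>x. 1)"
    using cont by (subst add) (auto simp: cmult simp del: mult_1_right intro!: continuous_intros)
  finally have "L f \<le> L g + e"
    using d(2) by linarith
  moreover have "closed C"
    unfolding C_def using cont by (intro closed_Collect_le continuous_intros)
  moreover have "C \<subseteq> U"
  proof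
    fix x assume "x \<in> C"
    then have "f x \<noteq> 0"
      using d(1) by (auto simp: C_def)
    then show "x \<in> U"
      using f by (auto simp: below_def)
  qed
  moreover have "g \<in> below C"
  proof -
    have "f x - d \<le> 1" for x
      using f d(1) by (auto simp: below_def intro: order_trans[of _ "f x"])
    then show ?thesis
      using cont(2) by (auto simp: below_def C_def g_def)
  qed
  ultimately show thesis
    using that by blast
qed

text \<open>After a cut to a closed \<open>C\<close> inside the union, a Urysohn function
  \<open>h\<close> that is 1 on \<open>C - V\<close> and 0 off \<open>U\<close> splits
  \<open>g\<close> into \<open>g * h\<close>, which lives in \<open>U\<close>, and
  \<open>g * (1 - h)\<close>, which lives in \<open>V\<close>.\<close>

lemma content_Un:
  assumes "open U" "open V"
  shows "content (U \<union> V) \<le> content U + content V"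
  unfolding content_def[of "U \<union> V"]
proof (rule SUP_least, rule ennreal_le_epsilon)
  fix f and e :: real
  assume f: "f \<in> below (U \<union> V)" and e: "0 < e"
  obtain C g where C: "closed C" "C \<subseteq> U \<union> V" and g: "g \<in> below C" "L f \<le> L g + e"
    using below_cut[OF f e] .
  have closed: "closed (C - V)" "closed (- U)" "(C - V) \<inter> - U = {}"
    using assms C by auto
  obtain h :: "'a \<Rightarrow> real" where h: "continuous_on UNIV h" "\<And>x. 0 \<le> h x" "\<And>x. h x \<le> 1"
    "\<And>x. x \<in> C - V \<Longrightarrow> h x = 1" "\<And>x. x \<in> - U \<Longrightarrow> h x = 0"
    by (rule compact_Urysohn[OF compact_UNIV closed]) (rule that)
  have cont: "continuous_on UNIV g" and g01: "\<And>x. 0 \<le> g x" "\<And>x. g x \<le> 1" "\<And>x. x \<notin> C \<Longrightarrow> g x = 0"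
    using g(1) by (auto simp: below_def)
  have U: "(\<lambda>x. g x * h x) \<in> below U"
    using cont h g01 by (auto simp: below_def intro!: continuous_intros mult_le_one)
  have "g x * (1 - h x) = 0" if "x \<notin> V" for x
    using that g01(3)[of x] h(4)[of x] by (cases "x \<in> C") auto
  then have V: "(\<lambda>x. g x * (1 - h x)) \<in> below V"
    using cont h g01 by (auto simp: below_def intro!: continuous_intros mult_le_one)
  have "L g = L (\<lambda>x. g x * h x + g x * (1 - h x))"
    by (simp add: algebra_simps)
  also have "\<dots> = L (\<lambda>x. g x * h x) + L (\<lambda>x. g x * (1 - h x))"
    using cont h by (intro add continuous_intros)
  finally have "ennreal (L f) \<le> ennreal (L (\<lambda>x. g x * h x) + L (\<lambda>x. g x * (1 - h x)) + e)"
    using g(2) by (intro ennreal_leI) simp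
  also have "\<dots> = ennreal (L (\<lambda>x. g x * h x)) + ennreal (L (\<lambda>x. g x * (1 - h x))) + ennreal e"
    using below_nonneg[OF U] below_nonneg[OF V] e by simp
  also have "\<dots> \<le> content U + content V + ennreal e"
    using content_upper[OF U] content_upper[OF V] by (intro add_mono) auto
  finally show "ennreal (L f) \<le> content U + content V + ennreal e" .
qed

lemma content_UN_finite:
  assumes "\<And>i. open (U i)"
  shows "content (\<Union>i<n::nat. U i) \<le> (\<Sum>i<n. content (U i))"
proof (induction n)
  case (Suc n)
  have "(\<Union>i<Suc n. U i) = (\<Union>i<n. U i) \<union> U n"
    by (auto simp: less_Suc_eq)
  then have "content (\<Union>i<Suc n. U i) \<le> content (\<Union>i<n. U i) + content (U n)"
    using assms by (simp add: content_Un open_UN)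
  also have "\<dots> \<le> (\<Sum>i<n. content (U i)) + content (U n)"
    by (intro add_right_mono Suc)
  finally show ?case
    by simp
qed (simp add: content_empty)

text \<open>The cut function is supported in a compact set, which finitely many of the
  \<open>U i\<close> cover, so finite subadditivity suffices up to \<open>e\<close>.\<close>

lemma content_UN:
  assumes U: "\<And>i. open (U i)"
  shows "content (\<Union>i::nat. U i) \<le> (\<Sum>i. content (U i))"
  unfolding content_def[of "\<Union>i. U i"]
proof (rule SUP_least, rule ennreal_le_epsilon)
  fix f and e :: real
  assume f: "f \<in> below (\<Union>i. U i)" and e: "0 < e"
  obtain C g where C: "closed C" "C \<subseteq> (\<Union>i. U i)" and g: "g \<in> below C" "L f \<le> L g + e"
    using below_cut[OF f e] .
  have "compact C"
    using compact_Int_closed[OF compact_UNIV C(1)] by simp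
  then obtain I where "finite I" "C \<subseteq> (\<Union>i\<in>I. U i)"
    using U C(2) by (metis compactE_image)
  moreover obtain n where "I \<subseteq> {..<n}"
    using \<open>finite I\<close> finite_nat_iff_bounded by blast
  ultimately have "C \<subseteq> (\<Union>i<n. U i)"
    by blast
  have "ennreal (L f) \<le> ennreal (L g + e)"
    using g(2) by (rule ennreal_leI)
  also have "\<dots> = ennreal (L g) + ennreal e"
    using below_nonneg[OF g(1)] e by simp
  also have "ennreal (L g) \<le> content C"
    by (rule content_upper[OF g(1)])
  also have "content C \<le> content (\<Union>i<n. U i)"
    by (rule content_mono) fact
  also have "\<dots> \<le> (\<Sum>i<n. content (U i))"
    by (rule content_UN_finite[OF U])
  also have "\<dots> \<le> (\<Sum>i. content (U i))"
    by (rule sum_le_suminf) auto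
  finally show "ennreal (L f) \<le> (\<Sum>i. content (U i)) + ennreal e"
    by (simp add: add_right_mono)
qed

lemma outer_open: "open U \<Longrightarrow> outer U = content U"
  unfolding outer_def by (intro antisym INF_lower INF_greatest) (auto intro: content_mono)

lemma outer_le_content: "open U \<Longrightarrow> A \<subseteq> U \<Longrightarrow> outer A \<le> content U"
  unfolding outer_def by (intro INF_lower) auto

lemma outer_mono: "A \<subseteq> B \<Longrightarrow> outer A \<le> outer B"
  unfolding outer_def by (rule INF_superset_mono) auto

lemma outer_finite: "outer A < \<infinity>"
proof -
  have "content UNIV \<le> ennreal (L (\<lambda>x. 1))"
    unfolding content_def by (intro SUP_least ennreal_leI mono) (auto simp: below_def)
  then show ?thesis
    using outer_le_content[of UNIV A] by (auto intro: le_less_trans[OF order_trans])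
qed

lemma outer_approx:
  assumes "e > 0"
  obtains U where "open U" "A \<subseteq> U" "content U < outer A + ennreal e"
proof -
  have "outer A < outer A + ennreal e"
    using outer_finite[of A] assms by (simp add: ennreal_add_left_cancel_less[of _ 0, simplified] less_top)
  then show thesis
    using that by (auto simp: outer_def[of A] INF_less_iff)
qed

lemma outer_measure_space_outer: "outer_measure_space (Pow UNIV) outer"
  unfolding outer_measure_space_def
proof (intro conjI)
  show "positive (Pow UNIV) outer"
    by (simp add: positive_def outer_open content_empty)
  show "increasing (Pow UNIV) outer"
    by (simp add: increasing_def outer_mono)
  show "countably_subadditive (Pow UNIV) outer"
    unfolding countably_subadditive_def
  proof (intro allI impI, rule ennreal_le_epsilon)
    fix A :: "nat \<Rightarrow> 'a set" and e :: real
    assume e: "0 < e"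
    have "\<exists>U. open U \<and> A i \<subseteq> U \<and> content U \<le> outer (A i) + ennreal (e * (1 / 2) ^ Suc i)" for i
    proof -
      have "0 < e * (1 / 2) ^ Suc i"
        using e by simp
      from outer_approx[OF this, of "A i"] show ?thesis
        by (metis less_imp_le)
    qed
    then obtain U where U: "\<And>i. open (U i)" "\<And>i. A i \<subseteq> U i"
      "\<And>i. content (U i) \<le> outer (A i) + ennreal (e * (1 / 2) ^ Suc i)"
      by metis
    have "outer (\<Union>i. A i) \<le> content (\<Union>i. U i)"
      using U by (intro outer_le_content) auto
    also have "\<dots> \<le> (\<Sum>i. content (U i))"
      by (rule content_UN[OF U(1)])
    also have "\<dots> \<le> (\<Sum>i. outer (A i) + ennreal (e * (1 / 2) ^ Suc i))"
      by (rule suminf_le[OF U(3)]) auto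
    also have "\<dots> = (\<Sum>i. outer (A i)) + (\<Sum>i. ennreal (e * (1 / 2) ^ Suc i))"
      by (rule suminf_add[symmetric]) auto
    also have "(\<Sum>i. ennreal (e * (1 / 2) ^ Suc i)) = ennreal e"
    proof -
      have "(\<lambda>i. e * (1 / 2) ^ Suc i) sums (e * 1)"
        by (rule sums_mult[OF power_half_series])
      then show ?thesis
        using e by (subst suminf_ennreal2) (auto simp: sums_iff)
    qed
    finally show "outer (\<Union>i. A i) \<le> (\<Sum>i. outer (A i)) + ennreal e" .
  qed
qed

text \<open>The hard half of Caratheodory's condition for open \<open>U\<close>, tested on open
  \<open>V\<close>. Once \<open>f\<close> is cut to \<open>g\<close> with closed support set
  \<open>C\<close>, the set \<open>V - C\<close> is open and contains \<open>V - U\<close>; for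
  every \<open>h\<close> below \<open>V - C\<close> the sum \<open>g + h\<close> is still below
  \<open>V\<close>, as \<open>g\<close> and \<open>h\<close> are never nonzero at the same
  point.\<close>

lemma content_Diff:
  assumes "open U" "open V"
  shows "content (U \<inter> V) + outer (V - U) \<le> content V"
proof -
  have "ennreal (L f) + outer (V - U) \<le> content V" if f: "f \<in> below (U \<inter> V)" for f
  proof (rule ennreal_le_epsilon)
    fix e :: real assume e: "0 < e"
    obtain C g where C: "closed C" "C \<subseteq> U \<inter> V" and g: "g \<in> below C" "L f \<le> L g + e"
      using below_cut[OF f e] .
    have "ennreal (L g) + ennreal (L h) \<le> content V" if h: "h \<in> below (V - C)" for h
    proof -
      have "0 \<le> g x + h x \<and> g x + h x \<le> 1 \<and> (x \<notin> V \<longrightarrow> g x + h x = 0)" for x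
        using g(1) h C(2) by (cases "x \<in> C") (auto simp: below_def)
      then have "(\<lambda>x. g x + h x) \<in> below V"
        using g(1) h by (auto simp: below_def intro!: continuous_intros)
      moreover have "L (\<lambda>x. g x + h x) = L g + L h"
        using g(1) h by (intro add) (auto simp: below_def)
      ultimately show ?thesis
        using content_upper below_nonneg[OF g(1)] below_nonneg[OF h] by fastforce
    qed
    then have *: "ennreal (L g) + content (V - C) \<le> content V"
      using zero_below unfolding content_def[of "V - C"]
      by (subst ennreal_SUP_add_right) (auto intro!: SUP_least)
    have "ennreal (L f) + outer (V - U) \<le> ennreal (L g + e) + content (V - C)"
      using assms C g(2) by (intro add_mono ennreal_leI outer_le_content) auto
    also have "\<dots> = ennreal (L g) + content (V - C) + ennreal e"
      using below_nonneg[OF g(1)] e by (simp add: ac_simps)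
    also have "\<dots> \<le> content V + ennreal e"
      by (rule add_right_mono[OF *])
    finally show "ennreal (L f) + outer (V - U) \<le> content V + ennreal e" .
  qed
  then show ?thesis
    using zero_below unfolding content_def[of "U \<inter> V"]
    by (subst ennreal_SUP_add_left[symmetric]) (auto intro!: SUP_least)
qed

text \<open>For arbitrary \<open>X\<close>, the splitting of \<open>X\<close> by \<open>U\<close> is
  compared with that of each open \<open>V\<close> containing \<open>X\<close>, where
  \<open>content_Diff\<close> applies; the infimum over \<open>V\<close> then gives
  \<open>outer X\<close>.\<close>

lemma open_in_lambda_system:
  assumes U: "open U"
  shows "U \<in> lambda_system UNIV (Pow UNIV) outer"
  unfolding lambda_system_def
proof (intro CollectI conjI ballI antisym)
  fix X :: "'a set"
  have "subadditive (Pow UNIV) outer"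
    using outer_measure_space_outer ring_of_sets.countably_subadditive_subadditive algebra.axioms(1)
      algebra_Pow unfolding outer_measure_space_def by metis
  then have "outer ((U \<inter> X) \<union> ((UNIV - U) \<inter> X)) \<le> outer (U \<inter> X) + outer ((UNIV - U) \<inter> X)"
    by (intro subadditiveD) auto
  moreover have "(U \<inter> X) \<union> ((UNIV - U) \<inter> X) = X"
    by blast
  ultimately show "outer X \<le> outer (U \<inter> X) + outer ((UNIV - U) \<inter> X)"
    by simp
  show "outer (U \<inter> X) + outer ((UNIV - U) \<inter> X) \<le> outer X"
    unfolding outer_def[of X]
  proof (rule INF_greatest)
    fix V assume V: "V \<in> {V. open V \<and> X \<subseteq> V}"
    then have "outer (U \<inter> X) + outer ((UNIV - U) \<inter> X) \<le> content (U \<inter> V) + outer (V - U)"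
      using U by (intro add_mono outer_le_content outer_mono) auto
    also have "\<dots> \<le> content V"
      using U V by (intro content_Diff) auto
    finally show "outer (U \<inter> X) + outer ((UNIV - U) \<inter> X) \<le> content V" .
  qed
qed simp

section \<open>The Riesz measure and its regularity\<close>

definition riesz_measure :: "'a measure" where
  "riesz_measure = measure_of UNIV (sets borel) outer"

lemma sets_riesz_measure: "sets riesz_measure = sets borel"
  using sets.sigma_sets_eq[of borel] by (simp add: riesz_measure_def)

text \<open>By Caratheodory, \<open>outer\<close> is a measure on its lambda system, a sigma-algebra
  that contains the open sets and hence all Borel sets.\<close>

lemma emeasure_riesz_measure:
  assumes "A \<in> sets borel"
  shows "emeasure riesz_measure A = outer A"
proof (rule emeasure_measure_of[OF riesz_measure_def])
  define \<Lambda> where "\<Lambda> = lambda_system UNIV (Pow UNIV) outer"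
  have ms: "measure_space UNIV \<Lambda> outer"
    unfolding \<Lambda>_def
    by (rule sigma_algebra.caratheodory_lemma[OF sigma_algebra_Pow outer_measure_space_outer])
  have "sets borel = sigma_sets UNIV (Collect open :: 'a set set)"
    by (simp add: borel_def)
  then have "sets borel \<subseteq> \<Lambda>"
    using sigma_algebra.sigma_sets_subset[of UNIV \<Lambda> "Collect open"] ms open_in_lambda_system
    by (auto simp: measure_space_def \<Lambda>_def)
  then show "positive (sets riesz_measure) outer" "countably_additive (sets riesz_measure) outer"
    using ms unfolding sets_riesz_measure measure_space_def positive_def countably_additive_def
    by (meson subset_trans sets.countable_UN subset_iff)+
qed (use assms in \<open>auto simp: sets_riesz_measure\<close>)

lemma finite_measure_riesz_measure: "finite_measure riesz_measure"
  using outer_finite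
  by (intro finite_measureI) (auto simp: emeasure_riesz_measure sets_eq_imp_space_eq[OF sets_riesz_measure] less_top)

lemma outer_approx_measure:
  assumes A: "A \<in> sets borel" and "e > 0"
  obtains U where "open U" "A \<subseteq> U" "measure riesz_measure (U - A) < e"
proof -
  interpret finite_measure riesz_measure
    by (rule finite_measure_riesz_measure)
  obtain U where U: "open U" "A \<subseteq> U" "content U < outer A + ennreal e"
    using outer_approx[OF \<open>e > 0\<close>] .
  then have "emeasure riesz_measure U < emeasure riesz_measure A + ennreal e"
    using A by (simp add: emeasure_riesz_measure outer_open)
  then have "measure riesz_measure U < measure riesz_measure A + e"
    using \<open>e > 0\<close> by (simp add: emeasure_eq_measure ennreal_less_iff flip: ennreal_plus)
  moreover have "measure riesz_measure (U - A) = measure riesz_measure U - measure riesz_measure A"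
    using A U by (intro finite_measure_Diff) (auto simp: sets_riesz_measure)
  ultimately show thesis
    using U that by simp
qed

text \<open>Inner regularity is outer regularity of the complement: an open \<open>V\<close> around
  \<open>- A\<close> has a complement that is closed, hence compact, and contained in
  \<open>A\<close>, and \<open>V - - A\<close> is what \<open>- V\<close> misses of
  \<open>A\<close>.\<close>

lemma regular_riesz_measure: "regular_measure riesz_measure"
  unfolding regular_measure_def
proof (intro conjI sets_riesz_measure finite_measure_riesz_measure ballI allI impI)
  interpret finite_measure riesz_measure
    by (rule finite_measure_riesz_measure)
  fix A :: "'a set" and e :: real
  assume A: "A \<in> sets borel" and e: "0 < e"
  obtain U where U: "open U" "A \<subseteq> U" "measure riesz_measure (U - A) < e / 2"
    using outer_approx_measure[OF A half_gt_zero[OF e]] .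
  obtain V where V: "open V" "- A \<subseteq> V" "measure riesz_measure (V - - A) < e / 2"
    using outer_approx_measure[OF borel_comp[OF A] half_gt_zero[OF e]] .
  have diffs: "U - A \<in> sets borel" "V - - A \<in> sets borel"
    using U V A borel_comp[OF A] by auto
  have "measure riesz_measure (U - - V) \<le> measure riesz_measure ((U - A) \<union> (V - - A))"
    using U V diffs by (intro finite_measure_mono) (auto simp: sets_riesz_measure)
  also have "\<dots> \<le> measure riesz_measure (U - A) + measure riesz_measure (V - - A)"
    using diffs by (intro measure_Un_le) (auto simp: sets_riesz_measure)
  also have "\<dots> < e"
    using U(3) V(3) by simp
  finally have "measure riesz_measure (U - - V) < e" .
  moreover have "compact (- V)"
    using compact_Int_closed[OF compact_UNIV, of "- V"] V by (simp add: closed_Compl)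
  ultimately show "\<exists>C U. compact C \<and> open U \<and> C \<subseteq> A \<and> A \<subseteq> U \<and> measure riesz_measure (U - C) < e"
    using U V by (intro exI[of _ "- V"] exI[of _ U]) auto
qed

lemma measure_open_eq:
  assumes "open U"
  shows "ennreal (measure riesz_measure U) = content U"
proof -
  interpret finite_measure riesz_measure
    by (rule finite_measure_riesz_measure)
  show ?thesis
    using assms by (simp add: emeasure_eq_measure[symmetric] emeasure_riesz_measure outer_open)
qed

section \<open>Representation of the functional as an integral\<close>

lemma integrable_riesz_measure:
  fixes f :: "'a \<Rightarrow> real"
  assumes f: "continuous_on UNIV f"
  shows "integrable riesz_measure f"
  using integrable_bcontfun[OF finite_measure_riesz_measure sets_riesz_measure, of "Bcontfun f"]
    continuous_imp_bcontfun[OF compact_UNIV f]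
  by (simp add: Bcontfun_inverse)

text \<open>\<open>L f\<close> and the integral of \<open>f\<close> both lie between the measures of
  \<open>V\<close> and \<open>U\<close>. For \<open>L\<close> the lower bound holds because every
  function below \<open>V\<close> is at most \<open>f\<close>.\<close>

lemma layer_bounds:
  assumes f: "f \<in> below U" and U: "open U" and V: "open V" "\<And>x. x \<in> V \<Longrightarrow> f x = 1"
  shows "\<bar>L f - (\<integral>x. f x \<partial>riesz_measure)\<bar> \<le> measure riesz_measure U - measure riesz_measure V"
proof -
  interpret finite_measure riesz_measure
    by (rule finite_measure_riesz_measure)
  have cont: "continuous_on UNIV f" and f01: "\<And>x. 0 \<le> f x" "\<And>x. f x \<le> 1" "\<And>x. x \<notin> U \<Longrightarrow> f x = 0"
    using f by (auto simp: below_def)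
  have sets: "U \<in> sets riesz_measure" "V \<in> sets riesz_measure"
    using U V by (auto simp: sets_riesz_measure)
  have "L f \<le> measure riesz_measure U"
    using content_upper[OF f] measure_open_eq[OF U] by (metis ennreal_le_iff measure_nonneg)
  moreover have "content V \<le> ennreal (L f)"
    unfolding content_def
  proof (intro SUP_least ennreal_leI mono)
    fix g x assume g: "g \<in> below V"
    show "g x \<le> f x"
      using g V(2) f01(1) by (cases "x \<in> V") (auto simp: below_def)
  qed (use cont in \<open>auto simp: below_def\<close>)
  then have "measure riesz_measure V \<le> L f"
    using measure_open_eq[OF V(1)] below_nonneg[OF f] by (metis ennreal_le_iff)
  moreover have "(\<integral>x. f x \<partial>riesz_measure) \<le> (\<integral>x. indicator U x \<partial>riesz_measure)"
    using f01 sets by (intro integral_mono integrable_riesz_measure cont integrable_real_indicator)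
      (auto simp: indicator_def less_top[symmetric])
  moreover have "(\<integral>x. indicator V x \<partial>riesz_measure) \<le> (\<integral>x. f x \<partial>riesz_measure)"
    using f01 V(2) sets by (intro integral_mono integrable_riesz_measure cont integrable_real_indicator)
      (auto simp: indicator_def less_top[symmetric])
  ultimately show ?thesis
    using sets by simp
qed

text \<open>The \<open>k\<close>-th summand is the portion of \<open>y\<close> between the heights
  \<open>k\<close> and \<open>k + 1\<close>.\<close>

lemma sum_layers:
  fixes y :: real
  assumes "0 \<le> y"
  shows "(\<Sum>k<n. max 0 (min 1 (y - real k))) = min y (real n)"
  using assms by (induction n) (auto simp: min_def max_def)

text \<open>Slicing \<open>n f\<close> into \<open>n\<close> horizontal layers: each layer is squeezed between the indicators of
  consecutive superlevel sets, so the errors telescope to at most the total mass.\<close>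

lemma riesz_representation_unit:
  assumes f: "continuous_on UNIV f" "\<And>x. 0 \<le> f x" "\<And>x. f x \<le> 1"
  shows "L f = (\<integral>x. f x \<partial>riesz_measure)"
proof -
  interpret finite_measure riesz_measure
    by (rule finite_measure_riesz_measure)
  define D where "D = L f - (\<integral>x. f x \<partial>riesz_measure)"
  have bound: "real n * \<bar>D\<bar> \<le> measure riesz_measure UNIV" for n
  proof -
    \<comment> \<open>The layer \<open>g k\<close> vanishes off \<open>U k\<close> and equals 1 on
      \<open>U (Suc k)\<close>, so these are the two open sets for
      \<open>layer_bounds\<close>.\<close>
    define g where "g k x = max 0 (min 1 (real n * f x - real k))" for k x
    define U where "U k = {x. real k < real n * f x}" for k :: nat
    have cont: "continuous_on UNIV (g k)" for k
      unfolding g_def using f by (intro continuous_intros)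
    have U: "open (U k)" for k
      unfolding U_def using f by (intro open_Collect_less continuous_intros)
    have nf: "(\<lambda>x. real n * f x) = (\<lambda>x. \<Sum>k<n. g k x)"
    proof
      fix x
      have "real n * f x \<le> real n"
        using f(3)[of x] by (simp add: mult_left_le)
      then show "real n * f x = (\<Sum>k<n. g k x)"
        using f(2)[of x] by (simp add: g_def sum_layers)
    qed
    have "real n * D = L (\<lambda>x. real n * f x) - (\<integral>x. real n * f x \<partial>riesz_measure)"
      using f by (simp add: D_def cmult right_diff_distrib)
    also have "\<dots> = (\<Sum>k<n. L (g k) - (\<integral>x. g k x \<partial>riesz_measure))"
      unfolding nf using cont by (simp add: sum sum_subtractf integrable_riesz_measure)
    finally have "real n * \<bar>D\<bar> = \<bar>\<Sum>k<n. L (g k) - (\<integral>x. g k x \<partial>riesz_measure)\<bar>"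
      by (metis abs_mult abs_of_nat)
    also have "\<dots> \<le> (\<Sum>k<n. \<bar>L (g k) - (\<integral>x. g k x \<partial>riesz_measure)\<bar>)"
      by (rule sum_abs)
    also have "\<dots> \<le> (\<Sum>k<n. measure riesz_measure (U k) - measure riesz_measure (U (Suc k)))"
    proof (intro sum_mono layer_bounds U)
      fix k
      show "g k \<in> below (U k)"
        using cont by (auto simp: below_def g_def U_def)
    qed (auto simp: g_def U_def)
    also have "\<dots> = measure riesz_measure (U 0) - measure riesz_measure (U n)"
      by (rule sum_lessThan_telescope')
    also have "\<dots> \<le> measure riesz_measure UNIV"
      using measure_nonneg[of riesz_measure "U n"] finite_measure_mono[of "U 0" UNIV]
      by (auto simp: sets_riesz_measure diff_le_eq intro: add_increasing2)
    finally show ?thesis .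
  qed
  have "D = 0"
  proof (rule ccontr)
    assume "D \<noteq> 0"
    then obtain n where "measure riesz_measure UNIV < real n * \<bar>D\<bar>"
      using reals_Archimedean3[of "\<bar>D\<bar>"] by auto
    with bound[of n] show False
      by simp
  qed
  then show ?thesis
    by (simp add: D_def)
qed

text \<open>An affine rescaling moves the bounded function \<open>f\<close> into the range from 0 to
  1 of the unit case, and linearity undoes it.\<close>

theorem riesz_representation:
  assumes f: "continuous_on UNIV f"
  shows "L f = (\<integral>x. f x \<partial>riesz_measure)"
proof -
  obtain B where B: "B > 0" "\<And>x. \<bar>f x\<bar> \<le> B"
    using compact_imp_bounded[OF compact_continuous_image[OF f compact_UNIV]]
    by (auto simp: bounded_pos)
  define g where "g x = (f x + B) / (2 * B)" for x
  have cont: "continuous_on UNIV g"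
    unfolding g_def using f B(1) by (intro continuous_intros) auto
  have g: "L g = (\<integral>x. g x \<partial>riesz_measure)"
  proof (rule riesz_representation_unit[OF cont])
    show "0 \<le> g x" "g x \<le> 1" for x
      using B(1) B(2)[of x] by (auto simp: g_def field_simps)
  qed
  have one: "L (\<lambda>x. 1) = (\<integral>x. 1 \<partial>riesz_measure)"
    by (rule riesz_representation_unit) auto
  have f_eq: "f = (\<lambda>x. (2 * B) * g x + (- B) * 1)"
    using B(1) by (auto simp: g_def)
  have "L f = (2 * B) * L g + (- B) * L (\<lambda>x. 1)"
    unfolding f_eq using cont
    by (simp only: add cmult continuous_on_mult_left continuous_on_const)
  also have "\<dots> = (\<integral>x. (2 * B) * g x + (- B) * 1 \<partial>riesz_measure)"
    using cont by (simp add: g one integrable_riesz_measure)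
  finally show ?thesis
    by (simp only: f_eq[symmetric])
qed

end

subsection \<open>Regular measures\<close>

text \<open>Uniqueness in the Riesz theorem, in the form of an inequality. A Urysohn function that
  is 1 on a compact \<open>C\<close> filling \<open>A\<close> up to small \<open>M\<close>-measure
  and 0 off an open \<open>U\<close> exceeding \<open>A\<close> by small \<open>N\<close>-measure
  has an integral between \<open>measure M C\<close> and \<open>measure N U\<close>.\<close>

lemma regular_measure_le_if_integral_eq:
  fixes M N :: "'a::t2_space measure"
  assumes compact: "compact (UNIV :: 'a set)" and M: "regular_measure M" and N: "regular_measure N"
    and eq: "\<And>f :: 'a \<Rightarrow>\<^sub>C real. (\<integral>x. apply_bcontfun f x \<partial>M) = (\<integral>x. apply_bcontfun f x \<partial>N)"
    and A: "A \<in> sets borel"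
  shows "measure M A \<le> measure N A"
proof (rule field_le_epsilon)
  fix e :: real assume e: "0 < e"
  interpret M: finite_measure M
    using M by (simp add: regular_measure_def)
  interpret N: finite_measure N
    using N by (simp add: regular_measure_def)
  have sets: "sets M = sets borel" "sets N = sets borel"
    using M N by (auto simp: regular_measure_def)
  obtain C U' where C: "compact C" "open U'" "C \<subseteq> A" "A \<subseteq> U'" "measure M (U' - C) < e / 2"
    using M A half_gt_zero[OF e] unfolding regular_measure_def by meson
  obtain C' U where U: "compact C'" "open U" "C' \<subseteq> A" "A \<subseteq> U" "measure N (U - C') < e / 2"
    using N A half_gt_zero[OF e] unfolding regular_measure_def by meson
  have borel: "C \<in> sets borel" "C' \<in> sets borel" "U \<in> sets borel" "U' \<in> sets borel"
    using C U by (auto simp: compact_imp_closed)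
  have closed: "closed C" "closed (- U)" "C \<inter> - U = {}"
    using C U by (auto simp: compact_imp_closed)
  obtain f :: "'a \<Rightarrow> real" where f: "continuous_on UNIV f" "\<And>x. 0 \<le> f x" "\<And>x. f x \<le> 1"
    "\<And>x. x \<in> C \<Longrightarrow> f x = 1" "\<And>x. x \<in> - U \<Longrightarrow> f x = 0"
    by (rule compact_Urysohn[OF compact closed]) (rule that)
  define F where "F = Bcontfun f"
  have F: "apply_bcontfun F = f"
    using continuous_imp_bcontfun[OF compact f(1)] by (simp add: F_def Bcontfun_inverse)
  have int: "integrable M f" "integrable N f"
    using integrable_bcontfun[OF M.finite_measure_axioms sets(1), of F]
      integrable_bcontfun[OF N.finite_measure_axioms sets(2), of F] by (simp_all add: F)
  have "measure M A \<le> measure M (C \<union> (U' - C))"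
    using C borel sets by (intro M.finite_measure_mono) auto
  also have "\<dots> \<le> measure M C + measure M (U' - C)"
    using borel sets by (intro measure_Un_le) auto
  also have "measure M C = (\<integral>x. indicator C x \<partial>M)"
    using borel sets by simp
  also have "\<dots> \<le> (\<integral>x. f x \<partial>M)"
    using f borel sets int by (intro integral_mono integrable_real_indicator)
      (auto simp: indicator_def less_top[symmetric])
  also have "\<dots> = (\<integral>x. f x \<partial>N)"
    using eq[of F] by (simp add: F)
  also have "\<dots> \<le> (\<integral>x. indicator U x \<partial>N)"
    using f borel sets int by (intro integral_mono integrable_real_indicator)
      (auto simp: indicator_def less_top[symmetric])
  also have "\<dots> = measure N U"
    using borel sets by simp
  also have "measure N U \<le> measure N (A \<union> (U - C'))"
    using U A borel sets by (intro N.finite_measure_mono) auto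
  also have "\<dots> \<le> measure N A + measure N (U - C')"
    using A borel sets by (intro measure_Un_le) auto
  finally show "measure M A \<le> measure N A + e"
    using C(5) U(5) by linarith
qed

text \<open>Compact sets \<open>C\<close> and \<open>D\<close> nearly exhaust the preimages of
  \<open>A\<close> and of \<open>- A\<close>. Their images are compact, so \<phi> \<open>C\<close>
  approximates \<open>A\<close> from inside and the complement of the image of \<open>D\<close> is
  an open approximation from outside.\<close>

lemma regular_measure_distr:
  fixes M :: "'a::t2_space measure" and \<phi> :: "'a \<Rightarrow> 'b::t2_space"
  assumes M: "regular_measure M" and \<phi>: "continuous_on UNIV \<phi>"
  shows "regular_measure (distr M borel \<phi>)"
  unfolding regular_measure_def
proof (intro conjI ballI allI impI)
  have sets: "sets M = sets borel"
    using M by (simp add: regular_measure_def)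
  have meas: "\<phi> \<in> borel_measurable borel"
    using \<phi> by (rule borel_measurable_continuous_onI)
  then have meas': "\<phi> \<in> borel_measurable M"
    by (simp add: measurable_cong_sets[OF sets refl])
  interpret finite_measure M
    using M by (simp add: regular_measure_def)
  show "finite_measure (distr M borel \<phi>)"
    using meas' by (rule finite_measure_distr)
  have space: "space M = UNIV"
    using sets_eq_imp_space_eq[OF sets] by simp
  have approx: "\<exists>C. compact C \<and> C \<subseteq> B \<and> measure M (B - C) < e" if B: "B \<in> sets borel" and e: "0 < e" for B e
  proof -
    obtain C U where C: "compact C" "open U" "C \<subseteq> B" "B \<subseteq> U" "measure M (U - C) < e"
      using M B e unfolding regular_measure_def by meson
    have "measure M (B - C) \<le> measure M (U - C)"
      using C sets by (intro finite_measure_mono) (auto simp: compact_imp_closed)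
    then show ?thesis
      using C by (intro exI[of _ C]) auto
  qed
  fix A :: "'b set" and e :: real
  assume A: "A \<in> sets borel" and e: "0 < e"
  have vimage: "\<phi> -` E \<in> sets borel" if "E \<in> sets borel" for E
    using measurable_sets[OF meas that] by simp
  obtain C where C: "compact C" "C \<subseteq> \<phi> -` A" "measure M (\<phi> -` A - C) < e / 2"
    using approx[OF vimage[OF A] half_gt_zero[OF e]] by blast
  obtain D where D: "compact D" "D \<subseteq> \<phi> -` (- A)" "measure M (\<phi> -` (- A) - D) < e / 2"
    using approx[OF vimage[OF borel_comp[OF A]] half_gt_zero[OF e]] by blast
  have img: "compact (\<phi> ` C)" "compact (\<phi> ` D)"
    using C D \<phi> by (auto intro!: compact_continuous_image intro: continuous_on_subset)
  define U where "U = - (\<phi> ` D)"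
  have U: "open U"
    unfolding U_def using img by (auto intro!: compact_imp_closed)
  have diffs: "\<phi> -` A - C \<in> sets borel" "\<phi> -` (- A) - D \<in> sets borel" "U - \<phi> ` C \<in> sets borel"
    using vimage[OF A] vimage[OF borel_comp[OF A]] C D U img by (auto simp: compact_imp_closed)
  have "measure (distr M borel \<phi>) (U - \<phi> ` C) = measure M (\<phi> -` (U - \<phi> ` C))"
    using diffs meas' by (simp add: measure_distr space)
  also have "\<dots> \<le> measure M ((\<phi> -` A - C) \<union> (\<phi> -` (- A) - D))"
    using diffs sets by (intro finite_measure_mono) (auto simp: U_def)
  also have "\<dots> \<le> measure M (\<phi> -` A - C) + measure M (\<phi> -` (- A) - D)"
    using diffs sets by (intro measure_Un_le) auto
  also have "\<dots> < e"
    using C D by linarith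
  finally show "\<exists>C U. compact C \<and> open U \<and> C \<subseteq> A \<and> A \<subseteq> U \<and> measure (distr M borel \<phi>) (U - C) < e"
    using img U C D by (intro exI[of _ "\<phi> ` C"] exI[of _ U]) (auto simp: U_def)
qed simp

text \<open>The functional sending \<open>f\<close> to the integral of \<open>u f\<close> against
  \<open>M\<close> is positive, and its Riesz measure is the adjoint of \<open>u\<close> applied to
  \<open>M\<close>.\<close>

lemma regular_adjoint:
  fixes u :: "('a::t2_space \<Rightarrow>\<^sub>C real) \<Rightarrow> ('b::topological_space \<Rightarrow>\<^sub>C real)"
  assumes compact: "compact (UNIV :: 'a set)" and u: "bounded_linear u"
    and pos: "\<And>f y. (\<And>x. 0 \<le> apply_bcontfun f x) \<Longrightarrow> 0 \<le> apply_bcontfun (u f) y"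
    and fin: "finite_measure M" and sets: "sets M = sets borel"
  shows "\<exists>P. regular_measure P \<and>
    (\<forall>f. (\<integral>x. apply_bcontfun f x \<partial>P) = (\<integral>y. apply_bcontfun (u f) y \<partial>M))"
proof -
  interpret u: bounded_linear u
    by (rule u)
  \<comment> \<open>On continuous functions \<open>Bcontfun\<close> inverts
    \<open>apply_bcontfun\<close>, as the space is compact. The locale asks nothing of
    \<open>L\<close> on other functions.\<close>
  define L where "L f = (\<integral>y. apply_bcontfun (u (Bcontfun f)) y \<partial>M)" for f
  note inv = Bcontfun_inverse[OF continuous_imp_bcontfun[OF compact]]
  interpret L: positive_functional L
  proof
    fix f g :: "'a \<Rightarrow> real" and c
    assume f: "continuous_on UNIV f"
    {
      assume g: "continuous_on UNIV g"
      have "Bcontfun (\<lambda>x. f x + g x) = Bcontfun f + Bcontfun g"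
        using f g by (intro bcontfun_eqI) (simp add: inv continuous_on_add)
      then show "L (\<lambda>x. f x + g x) = L f + L g"
        by (simp add: L_def u.add integrable_bcontfun[OF fin sets])
    }
    have "Bcontfun (\<lambda>x. c * f x) = c *\<^sub>R Bcontfun f"
      using f by (intro bcontfun_eqI) (simp add: inv continuous_on_mult_left)
    then show "L (\<lambda>x. c * f x) = c * L f"
      by (simp add: L_def u.scaleR)
    assume "\<And>x. 0 \<le> f x"
    then show "0 \<le> L f"
      unfolding L_def using f by (intro integral_nonneg_AE AE_I2 pos) (simp add: inv)
  qed (rule compact)
  have "(\<integral>x. apply_bcontfun f x \<partial>L.riesz_measure) = (\<integral>y. apply_bcontfun (u f) y \<partial>M)" for f
    using L.riesz_representation[of "apply_bcontfun f"] by (simp add: L_def apply_bcontfun_inverse)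
  then show ?thesis
    using L.regular_riesz_measure by blast
qed

subsection \<open>The weak* topology\<close>

lemma topspace_weak_star_topology: "topspace weak_star_topology = regular_signed_measures"
  by (simp add: weak_star_topology_def topspace_pullback_topology)

lemma continuous_map_signed_integral:
  fixes f :: "'a::topological_space \<Rightarrow>\<^sub>C real"
  shows "continuous_map weak_star_topology euclidean (\<lambda>\<mu>. signed_integral \<mu> f)"
proof -
  let ?I = "signed_integral :: ('a set \<Rightarrow> real) \<Rightarrow> ('a \<Rightarrow>\<^sub>C real) \<Rightarrow> real"
  have "continuous_map weak_star_topology euclidean (id \<circ> ?I)"
    unfolding weak_star_topology_def by (rule continuous_map_pullback) simp
  then show ?thesis
    using continuous_map_componentwise_UNIV[of weak_star_topology "\<lambda>_. euclidean" ?I]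
    by (simp add: euclidean_product_topology)
qed

text \<open>The universal property of the initial topology of the evaluations.\<close>

lemma continuous_map_weak_star_topologyI:
  assumes "\<And>\<mu>. \<mu> \<in> topspace X \<Longrightarrow> \<xi> \<mu> \<in> regular_signed_measures"
    and "\<And>f. continuous_map X euclidean (\<lambda>\<mu>. signed_integral (\<xi> \<mu>) f)"
  shows "continuous_map X weak_star_topology \<xi>"
  unfolding weak_star_topology_def
proof (rule continuous_map_pullback')
  show "continuous_map X euclidean (signed_integral \<circ> \<xi>)"
    using continuous_map_componentwise_UNIV[of X "\<lambda>_. euclidean" "signed_integral \<circ> \<xi>"] assms(2)
    by (simp add: euclidean_product_topology)
qed (use assms(1) in auto)

lemma compensation_nonneg:
  assumes "compensation \<nu> \<mu>" "A \<in> sets borel"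
  shows "0 \<le> \<nu> A"
  using assms by (cases "\<mu> UNIV > 0") (auto simp: compensation_def)

section \<open>Transfer of the compensation function along \<phi>\<close>

theorem lemma3p5:
  fixes \<phi> :: "'a::t2_space \<Rightarrow> 'b::t2_space"
  assumes "compact (UNIV :: 'a set)" and "compact (UNIV :: 'b set)"
    and "continuous_on UNIV \<phi>" and "surj \<phi>"
    and "\<exists>u. regular_averaging_operator \<phi> u"
    and "\<exists>\<xi> :: ('a set \<Rightarrow> real) \<Rightarrow> ('a set \<Rightarrow> real). compensation_function \<xi>"
  shows "\<exists>\<xi> :: ('b set \<Rightarrow> real) \<Rightarrow> ('b set \<Rightarrow> real). compensation_function \<xi>"
proof -
  note cK = assms(1) and cL = assms(2) and \<phi> = assms(3)
  obtain u where "regular_averaging_operator \<phi> u"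
    using assms(5) by blast
  then have u: "bounded_linear u"
    and pos: "\<And>f y. (\<And>x. 0 \<le> apply_bcontfun f x) \<Longrightarrow> 0 \<le> apply_bcontfun (u f) y"
    and u1: "u (const_bcontfun 1) = const_bcontfun 1"
    and u\<phi>: "u \<circ> composition_operator \<phi> = id"
    by (auto simp: regular_averaging_operator_def)
  obtain \<xi> :: "('a set \<Rightarrow> real) \<Rightarrow> ('a set \<Rightarrow> real)" where "compensation_function \<xi>"
    using assms(6) by blast
  then have \<xi>_cont: "continuous_map weak_star_topology weak_star_topology \<xi>"
    and \<xi>: "\<And>\<mu>. \<mu> \<in> regular_signed_measures \<Longrightarrow> compensation (\<xi> \<mu>) \<mu>"
    by (auto simp: compensation_function_def)
  have u_comp: "u (composition_operator \<phi> f) = f" for f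
    using fun_cong[OF u\<phi>, of f] by simp
  have comp: "apply_bcontfun (composition_operator \<phi> f) x = apply_bcontfun f (\<phi> x)" for f x
  proof -
    have "continuous_on UNIV (apply_bcontfun f \<circ> \<phi>)"
      using \<phi> by (intro continuous_on_compose continuous_on_apply_bcontfun)
    then show ?thesis
      by (simp add: composition_operator_def Bcontfun_inverse[OF continuous_imp_bcontfun[OF cK]])
  qed
  have meas: "\<phi> \<in> borel_measurable borel"
    using \<phi> by (rule borel_measurable_continuous_onI)
  have integral_distr_\<phi>: "(\<integral>y. apply_bcontfun f y \<partial>distr M borel \<phi>) =
      (\<integral>x. apply_bcontfun (composition_operator \<phi> f) x \<partial>M)"
    and measure_distr_\<phi>: "\<And>A. A \<in> sets borel \<Longrightarrow> measure (distr M borel \<phi>) A = measure M (\<phi> -` A)"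
    if "sets M = sets borel" for M and f :: "'b \<Rightarrow>\<^sub>C real"
  proof -
    have "\<phi> \<in> measurable M borel"
      using meas by (simp add: measurable_cong_sets[OF that refl])
    moreover have "space M = UNIV"
      using sets_eq_imp_space_eq[OF that] by simp
    ultimately show "(\<integral>y. apply_bcontfun f y \<partial>distr M borel \<phi>) =
      (\<integral>x. apply_bcontfun (composition_operator \<phi> f) x \<partial>M)"
      "\<And>A. A \<in> sets borel \<Longrightarrow> measure (distr M borel \<phi>) A = measure M (\<phi> -` A)"
      by (simp_all add: integral_distr borel_measurable_continuous_onI comp measure_distr)
  qed
  \<comment> \<open>For regular \<open>M\<close> this is \<open>u\<^sup>* M\<close>, chosen from
    \<open>regular_adjoint\<close>; for other \<open>M\<close> the value is arbitrary.\<close>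
  define R where "R M = (SOME P. regular_measure P \<and>
    (\<forall>f. (\<integral>x. apply_bcontfun f x \<partial>P) = (\<integral>y. apply_bcontfun (u f) y \<partial>M)))" for M
  have R: "regular_measure (R M)"
    "(\<integral>x. apply_bcontfun f x \<partial>R M) = (\<integral>y. apply_bcontfun (u f) y \<partial>M)"
    if "regular_measure M" for M f
  proof -
    have "finite_measure M" "sets M = sets borel"
      using that by (auto simp: regular_measure_def)
    from someI_ex[OF regular_adjoint[OF cK u pos this]]
    show "regular_measure (R M)"
      "(\<integral>x. apply_bcontfun f x \<partial>R M) = (\<integral>y. apply_bcontfun (u f) y \<partial>M)"
      by (auto simp: R_def)
  qed
  \<comment> \<open>Testing with the constant function 1, which \<open>u\<close> preserves, shows
    that the total mass is kept.\<close>
  have R_UNIV: "measure (R M) UNIV = measure M UNIV" if "regular_measure M" for M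
  proof -
    have "space (R M) = UNIV" "space M = UNIV"
      using that R(1)[OF that] by (auto simp: regular_measure_def dest: sets_eq_imp_space_eq)
    then show ?thesis
      using R(2)[OF that, of "const_bcontfun 1"] by (simp add: u1)
  qed
  \<comment> \<open>Pushing \<open>R M\<close> forward gives a regular measure with the same
    integrals as \<open>M\<close>, because \<open>u\<close> is a left inverse of composition with
    \<phi>.\<close>
  have distr_R_le: "measure (R M) (\<phi> -` A) \<le> measure M A" if M: "regular_measure M" and A: "A \<in> sets borel" for M A
  proof -
    have "measure (distr (R M) borel \<phi>) A \<le> measure M A"
    proof (rule regular_measure_le_if_integral_eq[OF cL regular_measure_distr[OF R(1)[OF M] \<phi>] M _ A])
      show "(\<integral>y. apply_bcontfun f y \<partial>distr (R M) borel \<phi>) = (\<integral>y. apply_bcontfun f y \<partial>M)"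
        for f :: "'b \<Rightarrow>\<^sub>C real"
        using R[OF M] by (simp add: integral_distr_\<phi> regular_measure_def u_comp)
    qed
    then show ?thesis
      using R(1)[OF M] A by (simp add: measure_distr_\<phi> regular_measure_def)
  qed
  \<comment> \<open>The adjoint of \<open>u\<close> on signed measures. Written as this difference,
    it has a positive part dominated by \<open>R (pos_measure \<mu>)\<close>.\<close>
  define adj where "adj \<mu> = (\<lambda>A. measure (R (pos_measure \<mu>)) A - measure (R (pos_measure (\<lambda>A. - \<mu> A))) A)"
    for \<mu> :: "'b set \<Rightarrow> real"
  \<comment> \<open>For regular \<mu> the compensation \<open>\<xi> (adj \<mu>)\<close> is
    nonnegative, hence equal to its positive part; \<open>pos_measure\<close> only turns it into a
    measure that can be pushed forward.\<close>
  define \<eta> where "\<eta> \<mu> = measure (distr (pos_measure (\<xi> (adj \<mu>))) borel \<phi>)" for \<mu>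
  have adj: "adj \<mu> \<in> regular_signed_measures"
    and adj_integral: "\<And>f. signed_integral (adj \<mu>) f = signed_integral \<mu> (u f)"
    and adj_UNIV: "adj \<mu> UNIV = \<mu> UNIV"
    and adj_le: "\<And>A. A \<in> sets borel \<Longrightarrow> pos_part (adj \<mu>) (\<phi> -` A) \<le> pos_part \<mu> A"
    if \<mu>: "\<mu> \<in> regular_signed_measures" for \<mu>
  proof -
    have bsm: "borel_signed_measure \<mu>"
      using \<mu> by (simp add: regular_signed_measures_def)
    note reg = regular_pos_measure[OF \<mu>]
    note RR = R(1)[OF reg(1)] R(1)[OF reg(2)]
    have fin: "finite_measure (R (pos_measure \<mu>))" "finite_measure (R (pos_measure (\<lambda>A. - \<mu> A)))"
      and sets: "sets (R (pos_measure \<mu>)) = sets borel" "sets (R (pos_measure (\<lambda>A. - \<mu> A))) = sets borel"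
      using RR by (auto simp: regular_measure_def)
    show "adj \<mu> \<in> regular_signed_measures"
      unfolding adj_def by (rule regular_signed_measures_diff[OF RR])
    show "signed_integral (adj \<mu>) f = signed_integral \<mu> (u f)" for f
      unfolding adj_def signed_integral_diff[OF fin sets]
      by (simp add: R(2)[OF reg(1)] R(2)[OF reg(2)] signed_integral_pos_measure)
    show "adj \<mu> UNIV = \<mu> UNIV"
      using neg_part_eq[OF bsm, of UNIV]
      by (simp add: adj_def R_UNIV[OF reg(1)] R_UNIV[OF reg(2)] measure_pos_measure bsm
          borel_signed_measure_uminus neg_part_def)
    fix A :: "'b set" assume A: "A \<in> sets borel"
    then have "\<phi> -` A \<in> sets borel"
      using measurable_sets[OF meas] by simp
    then have "pos_part (adj \<mu>) (\<phi> -` A) \<le> measure (R (pos_measure \<mu>)) (\<phi> -` A)"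
      unfolding adj_def by (rule pos_part_diff_le[OF fin(1) sets(1)])
    also have "\<dots> \<le> pos_part \<mu> A"
      using distr_R_le[OF reg(1) A] by (simp add: measure_pos_measure bsm)
    finally show "pos_part (adj \<mu>) (\<phi> -` A) \<le> pos_part \<mu> A" .
  qed
  have \<xi>_reg: "\<xi> \<kappa> \<in> regular_signed_measures" and \<xi>_measure: "measure (pos_measure (\<xi> \<kappa>)) = \<xi> \<kappa>"
    if "\<kappa> \<in> regular_signed_measures" for \<kappa>
  proof -
    show reg: "\<xi> \<kappa> \<in> regular_signed_measures"
      using \<xi>[OF that] by (simp add: compensation_def)
    then have "borel_signed_measure (\<xi> \<kappa>)"
      by (simp add: regular_signed_measures_def)
    then show "measure (pos_measure (\<xi> \<kappa>)) = \<xi> \<kappa>"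
      using compensation_nonneg[OF \<xi>[OF that]] by (simp add: measure_pos_measure pos_part_of_nonneg)
  qed
  have \<eta>_reg: "\<eta> \<mu> \<in> regular_signed_measures"
    and \<eta>_eq: "\<And>A. A \<in> sets borel \<Longrightarrow> \<eta> \<mu> A = \<xi> (adj \<mu>) (\<phi> -` A)"
    and \<eta>_integral: "\<And>f. signed_integral (\<eta> \<mu>) f = signed_integral (\<xi> (adj \<mu>)) (composition_operator \<phi> f)"
    if \<mu>: "\<mu> \<in> regular_signed_measures" for \<mu>
  proof -
    define M where "M = pos_measure (\<xi> (adj \<mu>))"
    have M: "regular_measure M" and measM: "measure M = \<xi> (adj \<mu>)"
      unfolding M_def by (rule regular_pos_measure[OF \<xi>_reg[OF adj[OF \<mu>]]], rule \<xi>_measure[OF adj[OF \<mu>]])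
    have distr: "regular_measure (distr M borel \<phi>)"
      by (rule regular_measure_distr[OF M \<phi>])
    have sets: "sets M = sets borel" and fin: "finite_measure M" "finite_measure (distr M borel \<phi>)"
      using M distr by (auto simp: regular_measure_def)
    have \<eta>: "\<eta> \<mu> = measure (distr M borel \<phi>)"
      by (simp add: \<eta>_def M_def)
    show "\<eta> \<mu> \<in> regular_signed_measures"
      unfolding \<eta> by (rule regular_signed_measures_measure[OF distr])
    show "\<eta> \<mu> A = \<xi> (adj \<mu>) (\<phi> -` A)" if "A \<in> sets borel" for A
      using that by (simp add: \<eta> measure_distr_\<phi>[OF sets] measM)
    show "signed_integral (\<eta> \<mu>) f = signed_integral (\<xi> (adj \<mu>)) (composition_operator \<phi> f)" for f
      unfolding \<eta> measM[symmetric]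
      by (simp add: signed_integral_measure fin sets integral_distr_\<phi>)
  qed
  have "compensation (\<eta> \<mu>) \<mu>" if \<mu>: "\<mu> \<in> regular_signed_measures" for \<mu>
    unfolding compensation_def
  proof (intro conjI impI ballI)
    \<comment> \<open>By \<open>adj_UNIV\<close> the case distinction for \<open>adj \<mu>\<close>
      is the one for \<mu>.\<close>
    note comp_adj = \<xi>[OF adj[OF \<mu>], unfolded compensation_def adj_UNIV[OF \<mu>]]
    have vimage: "\<phi> -` A \<in> sets borel" if "A \<in> sets borel" for A
      using measurable_sets[OF meas that] by simp
    show "\<eta> \<mu> UNIV = \<mu> UNIV" if "\<mu> UNIV > 0"
      using comp_adj that by (simp add: \<eta>_eq[OF \<mu>])
    show "0 \<le> \<eta> \<mu> A" if "\<mu> UNIV > 0" "A \<in> sets borel" for A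
      using comp_adj that vimage by (simp add: \<eta>_eq[OF \<mu>])
    show "\<eta> \<mu> A \<le> pos_part \<mu> A" if "\<mu> UNIV > 0" "A \<in> sets borel" for A
      \<comment> \<open>The chain runs from \<open>\<xi> (adj \<mu>) (\<phi> -\<close>
        A)\<open>through\<close>pos_part (adj \<mu>) (\<phi> -\<open>A)\<close> to
        \<open>pos_part \<mu> A\<close>.\<close>
      using comp_adj that vimage[OF that(2)] adj_le[OF \<mu> that(2)] \<eta>_eq[OF \<mu> that(2)] by fastforce
    show "\<eta> \<mu> = (\<lambda>_. 0)" if "\<mu> UNIV \<le> 0"
    proof
      fix A
      \<comment> \<open>Equality of functions includes the non-Borel sets, where
        \<open>measure\<close> has the default value 0.\<close>
      show "\<eta> \<mu> A = 0"
        using comp_adj that \<eta>_eq[OF \<mu>, of A]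
        by (cases "A \<in> sets borel") (auto simp: \<eta>_def measure_notin_sets)
    qed
  qed (use \<mu> \<eta>_reg in auto)
  moreover have "continuous_map weak_star_topology weak_star_topology \<eta>"
  proof (rule continuous_map_weak_star_topologyI)
    have adj_cont: "continuous_map weak_star_topology weak_star_topology adj"
    proof (rule continuous_map_weak_star_topologyI)
      show "continuous_map weak_star_topology euclidean (\<lambda>\<mu>. signed_integral (adj \<mu>) f)" for f
        using continuous_map_signed_integral[of "u f"]
        by (rule continuous_map_eq) (simp add: topspace_weak_star_topology adj_integral)
    qed (simp add: topspace_weak_star_topology adj)
    \<comment> \<open>Evaluating \<eta> at \<open>f\<close> amounts to evaluating \<xi> after
      \<open>adj\<close> at the composition of \<open>f\<close> with \<phi>, which is weak*
      continuous.\<close>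
    show "continuous_map weak_star_topology euclidean (\<lambda>\<mu>. signed_integral (\<eta> \<mu>) f)" for f
      using continuous_map_compose[OF continuous_map_compose[OF adj_cont \<xi>_cont]
          continuous_map_signed_integral[of "composition_operator \<phi> f"]]
      by (rule continuous_map_eq) (simp add: topspace_weak_star_topology \<eta>_integral)
  qed (simp add: topspace_weak_star_topology \<eta>_reg)
  ultimately show ?thesis
    by (auto simp: compensation_function_def)
qed

end
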